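(* Let $r$ be a positive integer and $T=r^{5r^2}$. Then there exist a finite point set $\mathcal{P}\subset\mathbb{R}^2$ and a finite set $\mathcal{L}$ of lines in $\mathbb{R}^2$ such that every point of $\mathcal{P}$ lies on at least $r$ lines of $\mathcal{L}$, every line of $\mathcal{L}$ is intersected, at points of $\mathcal{P}$, by at most $T$ other lines of $\mathcal{L}$, and $\mathcal{L}$ cannot be decomposed into two covering systems, i.e., there is no partition $\mathcal{L}=\mathcal{L}_1\cup\mathcal{L}_2$ such that every point of $\mathcal{P}$ lies on a line of $\mathcal{L}_1$ and on a line of $\mathcal{L}_2$. *)

theory Defs
  imports Complex_Main
begin

definition is_line :: "(real \<times> real) set \<Rightarrow> bool" where
  "is_line l \<longleftrightarrow> (\<exists>a b c. (a \<noteq> 0 \<or> b \<noteq> 0) \<and> l = {(x, y). a * x + b * y = c})"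

end

theory Submission
  imports Defs "HOL-Library.FuncSet"
begin

text \<open>
  Dually, one needs points of a cube \<open>[n]\<^sup>D\<close> and axis-parallel lines: a generic projection to the plane
  followed by point-line duality turns cube points into lines and axis-parallel lines into points. We want a
  point set \<open>V\<close> with at most \<open>r\<close> points on each axis-parallel line, few \<open>r\<close>-point lines through each of its
  points, and no partition into two independent sets, where a set is independent if it has fewer than \<open>r\<close>
  points on each axis-parallel line.

  \<open>V\<close> is a random sequence of \<open>m\<close> points with few bad points deleted. To count the sequences that can be
  split into two independent classes, let \<open>Z(S)\<close> be the sum of \<open>t\<^bsup>|R|\<^esup>\<close> over all \<open>R\<close> with \<open>R \<union> S\<close>
  independent; \<open>1 \<le> Z(S) \<le> (1 + t)\<^bsup>N\<^esup>\<close> for independent \<open>S\<close>, where \<open>N = n\<^sup>D\<close>. If adding \<open>v\<close> to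
  \<open>S\<close> hardly decreases \<open>Z\<close> for at least \<open>N/8\<close> points \<open>v\<close>, then under the random \<open>R\<close> weighted by
  \<open>t\<^bsup>|R|\<^esup>\<close> these points are almost always addable to \<open>R\<close>, and a second moment argument shows, by induction
  on \<open>k\<close>, that \<open>R\<close> contains almost as many collinear \<open>k\<close>-sets as an unconstrained random set; this is absurd
  for \<open>k = r\<close>. Hence each further point of a colour class either has few choices or decreases \<open>Z\<close> by a
  constant factor, which leaves fewer than \<open>N\<^sup>m/2\<close> splittable sequences.
\<close>

section \<open>Random faces of a simplicial complex\<close>

locale weighted_complex =
  fixes \<Omega> :: "'a set" and \<R> :: "'a set set" and t :: real
  assumes finite_ground: "finite \<Omega>" and subsets: "\<R> \<subseteq> Pow \<Omega>"
    and down: "\<And>R R'. R \<in> \<R> \<Longrightarrow> R' \<subseteq> R \<Longrightarrow> R' \<in> \<R>"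
    and empty_mem: "{} \<in> \<R>" and t_pos: "t > 0"
begin

text \<open>Unnormalised expectation over a random face \<open>R\<close> of weight
  \<open>t ^ card R\<close>. The normalising constant is \<open>E (\<lambda>_. 1)\<close>; keeping
  it explicit avoids divisions.\<close>

definition E :: "('a set \<Rightarrow> real) \<Rightarrow> real" where
  "E f = (\<Sum>R\<in>\<R>. t ^ card R * f R)"

lemma finite_R: "finite \<R>"
  using finite_ground subsets finite_subset by blast

lemma finite_mem: "R \<in> \<R> \<Longrightarrow> finite R"
  using finite_ground subsets finite_subset by blast

lemma E_mono: "(\<And>R. R \<in> \<R> \<Longrightarrow> f R \<le> g R) \<Longrightarrow> E f \<le> E g"
  unfolding E_def using t_pos by (intro sum_mono mult_left_mono) auto

lemma E_cong: "(\<And>R. R \<in> \<R> \<Longrightarrow> f R = g R) \<Longrightarrow> E f = E g"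
  unfolding E_def by (intro sum.cong) auto

lemma E_cmult: "E (\<lambda>R. a * f R) = a * E f"
  unfolding E_def by (simp add: sum_distrib_left mult_ac)

lemma E_add: "E (\<lambda>R. f R + g R) = E f + E g"
  unfolding E_def by (simp add: sum.distrib distrib_left)

lemma E_sum: "E (\<lambda>R. \<Sum>i\<in>I. f i R) = (\<Sum>i\<in>I. E (f i))"
  unfolding E_def by (simp add: sum_distrib_left sum.swap[of _ I])

lemma E_one_ge_1: "E (\<lambda>_. 1) \<ge> 1"
proof -
  have "(\<Sum>R\<in>{{} :: 'a set}. t ^ card R * 1) \<le> E (\<lambda>_. 1)"
    unfolding E_def using finite_R empty_mem t_pos by (intro sum_mono2) auto
  then show ?thesis by simp
qed

text \<open>Deleting \<open>L\<close> maps the faces containing \<open>L\<close> injectively into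
  the faces, because the complex is closed downwards, and divides each weight by
  \<open>t ^ card L\<close>.\<close>

lemma E_superset_le:
  assumes "finite L"
  shows "E (\<lambda>R. of_bool (L \<subseteq> R)) \<le> t ^ card L * E (\<lambda>_. 1)"
proof -
  have "E (\<lambda>R. of_bool (L \<subseteq> R)) = (\<Sum>R\<in>{R\<in>\<R>. L \<subseteq> R}. t ^ card R)"
    unfolding E_def using finite_R by (intro sum.mono_neutral_cong_right) auto
  also have "\<dots> = (\<Sum>R\<in>{R\<in>\<R>. L \<subseteq> R}. t ^ card L * t ^ card (R - L))"
  proof (intro sum.cong refl)
    fix R assume "R \<in> {R\<in>\<R>. L \<subseteq> R}"
    then have "card R = card L + card (R - L)"
      using finite_mem assms by (metis (mono_tags, lifting) card_Diff_subset card_mono le_add_diff_inverse mem_Collect_eq)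
    then show "t ^ card R = t ^ card L * t ^ card (R - L)" by (simp add: power_add)
  qed
  also have "\<dots> = t ^ card L * (\<Sum>R\<in>(\<lambda>R. R - L) ` {R\<in>\<R>. L \<subseteq> R}. t ^ card R)"
    by (subst sum.reindex) (auto simp: inj_on_def sum_distrib_left)
  also have "\<dots> \<le> t ^ card L * (\<Sum>R\<in>\<R>. t ^ card R)"
    using finite_R t_pos down by (intro mult_left_mono sum_mono2) auto
  finally show ?thesis by (simp add: E_def)
qed

text \<open>Inserting \<open>v\<close> is a bijection from the faces to which \<open>v\<close> can
  be newly added onto the faces containing \<open>v\<close>, and multiplies the weight by
  \<open>t\<close>. Membership of \<open>v\<close> is thereby expressed through its
  addability.\<close>

lemma E_insert:
  assumes v: "v \<in> \<Omega>" and f: "\<And>R. f (insert v R) = f R"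
  shows "E (\<lambda>R. of_bool (v \<in> R) * f R) = t * E (\<lambda>R. of_bool (v \<notin> R \<and> insert v R \<in> \<R>) * f R)"
proof -
  let ?A = "{R\<in>\<R>. v \<in> R}" and ?B = "{R\<in>\<R>. v \<notin> R \<and> insert v R \<in> \<R>}"
  have im: "?A = insert v ` ?B"
  proof (intro equalityI subsetI)
    fix R assume "R \<in> ?A"
    then have "R - {v} \<in> ?B" "R = insert v (R - {v})"
      using down[of R "R - {v}"] by (auto simp: insert_absorb)
    then show "R \<in> insert v ` ?B" by blast
  qed auto
  have "E (\<lambda>R. of_bool (v \<in> R) * f R) = (\<Sum>R\<in>?A. t ^ card R * f R)"
    unfolding E_def using finite_R by (intro sum.mono_neutral_cong_right) auto
  also have "\<dots> = (\<Sum>R\<in>?B. t ^ card (insert v R) * f R)"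
    unfolding im using f by (subst sum.reindex) (auto intro!: inj_onI dest: insert_ident[THEN iffD1, rotated 2])
  also have "\<dots> = (\<Sum>R\<in>?B. t * (t ^ card R * f R))"
    using finite_mem by (intro sum.cong) auto
  also have "\<dots> = t * E (\<lambda>R. of_bool (v \<notin> R \<and> insert v R \<in> \<R>) * f R)"
    unfolding E_def sum_distrib_left[symmetric] using finite_R
    by (intro arg_cong[where f="(*) t"] sum.mono_neutral_cong_left) auto
  finally show ?thesis .
qed

lemma binomial_card_Int:
  assumes "finite A"
  shows "real (card (R \<inter> A) choose k) = (\<Sum>L\<in>{L. L \<subseteq> A \<and> card L = k}. of_bool (L \<subseteq> R))"
proof -
  have "(\<Sum>L\<in>{L. L \<subseteq> A \<and> card L = k}. of_bool (L \<subseteq> R)) = (\<Sum>L\<in>{L. L \<subseteq> R \<inter> A \<and> card L = k}. (1::real))"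
    using assms by (intro sum.mono_neutral_cong_right) auto
  then show ?thesis using n_subsets[of "R \<inter> A" k] assms by simp
qed

lemma E_binomial_le:
  assumes "finite A"
  shows "E (\<lambda>R. real (card (R \<inter> A) choose k)) \<le> real (card A choose k) * t ^ k * E (\<lambda>_. 1)"
proof -
  have "E (\<lambda>R. real (card (R \<inter> A) choose k))
      = (\<Sum>L\<in>{L. L \<subseteq> A \<and> card L = k}. E (\<lambda>R. of_bool (L \<subseteq> R)))"
    by (simp only: binomial_card_Int[OF assms] E_sum)
  also have "\<dots> \<le> (\<Sum>L\<in>{L. L \<subseteq> A \<and> card L = k}. t ^ k * E (\<lambda>_. 1))"
    using assms by (intro sum_mono order.trans[OF E_superset_le]) (auto intro: finite_subset)
  finally show ?thesis using n_subsets[OF assms, of k] by simp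
qed

text \<open>The product of binomials counts pairs of \<open>k\<close>-sets. Disjointness of
  \<open>A\<close> and \<open>B\<close> gives each union exactly \<open>2 * k\<close> elements, so
  the bound is the product of the two first-moment bounds.\<close>

lemma E_binomial_prod_le:
  assumes A: "finite A" and B: "finite B" and disj: "A \<inter> B = {}"
  shows "E (\<lambda>R. real (card (R \<inter> A) choose k) * real (card (R \<inter> B) choose k))
       \<le> (real (card A choose k) * t ^ k) * (real (card B choose k) * t ^ k) * E (\<lambda>_. 1)"
proof -
  let ?S = "\<lambda>A. {L. L \<subseteq> A \<and> card L = k}"
  have "E (\<lambda>R. real (card (R \<inter> A) choose k) * real (card (R \<inter> B) choose k))
      = E (\<lambda>R. \<Sum>L\<in>?S A. \<Sum>L'\<in>?S B. of_bool (L \<union> L' \<subseteq> R))"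
    by (simp only: binomial_card_Int[OF A] binomial_card_Int[OF B] sum_product of_bool_conj Un_subset_iff)
  also have "\<dots> = (\<Sum>L\<in>?S A. \<Sum>L'\<in>?S B. E (\<lambda>R. of_bool (L \<union> L' \<subseteq> R)))"
    by (simp only: E_sum)
  also have "\<dots> \<le> (\<Sum>L\<in>?S A. \<Sum>L'\<in>?S B. (t ^ k * t ^ k) * E (\<lambda>_. 1))"
  proof (intro sum_mono)
    fix L L' assume L: "L \<in> ?S A" "L' \<in> ?S B"
    then have "finite L" "finite L'" "L \<inter> L' = {}" using A B disj by (auto intro: finite_subset)
    then have "card (L \<union> L') = k + k" using L by (simp add: card_Un_disjoint)
    then show "E (\<lambda>R. of_bool (L \<union> L' \<subseteq> R)) \<le> (t ^ k * t ^ k) * E (\<lambda>_. 1)"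
      using E_superset_le[of "L \<union> L'"] \<open>finite L\<close> \<open>finite L'\<close> by (simp add: power_add)
  qed
  also have "\<dots> = (real (card A choose k) * t ^ k) * (real (card B choose k) * t ^ k) * E (\<lambda>_. 1)"
    using n_subsets[OF A, of k] n_subsets[OF B, of k] by simp
  finally show ?thesis .
qed

text \<open>If almost every vertex of \<open>C\<close> can be added to a random face, then the linear family \<open>\<K>\<close> behaves
  as under the unconditioned product measure, so some face meets a member of \<open>\<K>\<close> in \<open>r\<close> vertices.\<close>

lemma linear_family_meets_face:
  fixes r c :: nat
  assumes C: "C \<subseteq> \<Omega>" "C \<noteq> {}"
    and K: "finite \<K>" "\<And>K. K \<in> \<K> \<Longrightarrow> K \<subseteq> C" "\<And>K. K \<in> \<K> \<Longrightarrow> card K = c"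
    and lin: "\<And>K K'. K \<in> \<K> \<Longrightarrow> K' \<in> \<K> \<Longrightarrow> K \<noteq> K' \<Longrightarrow> card (K \<inter> K') \<le> 1"
    and free: "\<And>v. v \<in> C \<Longrightarrow>
        E (\<lambda>R. of_bool (\<not> (v \<notin> R \<and> insert v R \<in> \<R>))) \<le> E (\<lambda>_. 1) / (real r + 1)\<^sup>2"
    and rich: "\<And>k. k < r \<Longrightarrow> (real r + 1) * 2 ^ (r - 1) * real (card C)
        \<le> real (card \<K>) * real c * (real ((c - 1) choose k) * t ^ k)"
    and rc: "0 < r" "r \<le> c"
  shows "\<exists>R\<in>\<R>. \<exists>K\<in>\<K>. card (R \<inter> K) \<ge> r"
proof (rule ccontr)
  assume "\<not> ?thesis"
  then have few: "\<And>R K. R \<in> \<R> \<Longrightarrow> K \<in> \<K> \<Longrightarrow> card (R \<inter> K) < r" by force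
  define Z where "Z = E (\<lambda>_. 1)"
  have Z: "Z \<ge> 1" unfolding Z_def by (rule E_one_ge_1)
  define M where "M = real (card \<K>)"
  have finC: "finite C" using C finite_ground finite_subset by blast
  have finK: "finite K" if "K \<in> \<K>" for K using K(2)[OF that] finC finite_subset by blast
  \<comment> \<open>Counts pairs of a member \<open>K\<close> through \<open>v\<close> and a
    \<open>k\<close>-subset of \<open>R\<close> inside \<open>K - {v}\<close>. The value is
    unchanged when \<open>v\<close> is inserted into \<open>R\<close>, as \<open>E_insert\<close>
    requires.\<close>
  define X where "X k v R = (\<Sum>K\<in>{K\<in>\<K>. v \<in> K}. real (card (R \<inter> (K - {v})) choose k))" for k v R
  define q where "q k = E (\<lambda>R. \<Sum>K\<in>\<K>. real (card (R \<inter> K) choose k))" for k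
  \<comment> \<open>\<open>b k\<close>, multiplied by \<open>Z\<close>, is the bound of
    \<open>E_binomial_le\<close> for a single set \<open>K - {v}\<close>.\<close>
  define b where "b k = real ((c - 1) choose k) * t ^ k" for k
  define d where "d v = real (card {K\<in>\<K>. v \<in> K})" for v
  have b0: "b k \<ge> 0" for k unfolding b_def using t_pos by simp
  have Xnn: "X k v R \<ge> 0" for k v R unfolding X_def by (intro sum_nonneg) auto
  have Mpos: "M > 0"
  proof (rule ccontr)
    assume "\<not> M > 0"
    then have "M = 0" unfolding M_def by simp
    moreover have "(real r + 1) * 2 ^ (r - 1) * real (card C) > 0"
      using C finC by (simp add: card_gt_0_iff add_nonneg_pos)
    ultimately show False using rich[of 0] rc by (simp add: M_def)
  qed
  have sumX: "(\<Sum>v\<in>C. X k v R) = (\<Sum>K\<in>\<K>. \<Sum>v\<in>K. real (card (R \<inter> (K - {v})) choose k))" for k R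
  proof -
    have "(\<Sum>v\<in>C. X k v R) = (\<Sum>K\<in>\<K>. \<Sum>v\<in>{v\<in>C. v \<in> K}. real (card (R \<inter> (K - {v})) choose k))"
      unfolding X_def using finC K(1) by (subst sum.swap_restrict) auto
    moreover have "{v\<in>C. v \<in> K} = K" if "K \<in> \<K>" for K using K(2)[OF that] by blast
    ultimately show ?thesis by simp
  qed
  have sumX': "(\<Sum>v\<in>C. of_bool (v \<in> R) * X k v R)
      = (\<Sum>K\<in>\<K>. \<Sum>v\<in>K. of_bool (v \<in> R) * real (card (R \<inter> (K - {v})) choose k))" for k R
  proof -
    have "(\<Sum>v\<in>C. of_bool (v \<in> R) * X k v R)
        = (\<Sum>K\<in>\<K>. \<Sum>v\<in>{v\<in>C. v \<in> K}. of_bool (v \<in> R) * real (card (R \<inter> (K - {v})) choose k))"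
      unfolding X_def sum_distrib_left using finC K(1) by (subst sum.swap_restrict) auto
    moreover have "{v\<in>C. v \<in> K} = K" if "K \<in> \<K>" for K using K(2)[OF that] by blast
    ultimately show ?thesis by simp
  qed
  have card_in: "card (R \<inter> (K - {v})) = card (R \<inter> K) - of_bool (v \<in> R)" if "v \<in> K" "finite K" for R K :: "'a set" and v
  proof -
    have "R \<inter> (K - {v}) = (R \<inter> K) - {v}" by blast
    then show ?thesis using that by (simp add: card_Diff_singleton_if)
  qed
  have absorb: "real j * real ((j - 1) choose k) = (real k + 1) * real (j choose Suc k)" for j k
    using binomial_absorption[of k j] by (metis add.commute of_nat_Suc of_nat_mult)
  have absorb': "real j * real ((j - 1) choose k) = (real j - real k) * real (j choose k)" for j k
  proof (cases "k \<le> j")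
    case True
    then show ?thesis using binomial_absorb_comp[of j k] by (metis of_nat_diff of_nat_mult)
  qed (simp add: binomial_eq_0)
  have split: "(\<Sum>v\<in>K. f (of_bool (v \<in> R))) = real (card (R \<inter> K)) * f 1 + (real c - real (card (R \<inter> K))) * f 0"
    if "K \<in> \<K>" for f :: "nat \<Rightarrow> real" and K R
  proof -
    have fK: "finite K" by (rule finK[OF that])
    have "(\<Sum>v\<in>K. f (of_bool (v \<in> R))) = (\<Sum>v\<in>R \<inter> K. f (of_bool (v \<in> R))) + (\<Sum>v\<in>K - R \<inter> K. f (of_bool (v \<in> R)))"
      using fK by (subst add.commute, subst sum.subset_diff[symmetric]) auto
    also have "\<dots> = (\<Sum>v\<in>R \<inter> K. f 1) + (\<Sum>v\<in>K - R \<inter> K. f 0)"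
      by (intro arg_cong2[where f="(+)"] sum.cong) auto
    also have "\<dots> = real (card (R \<inter> K)) * f 1 + (real c - real (card (R \<inter> K))) * f 0"
      using fK K(3)[OF that] card_mono[OF fK, of "R \<inter> K"] by (simp add: card_Diff_subset of_nat_diff)
    finally show ?thesis .
  qed
  \<comment> \<open>A \<open>k\<close>-subset of \<open>R \<inter> K\<close> is counted once for
    each of the \<open>c - k\<close> vertices of \<open>K\<close> outside it.\<close>
  have q_out: "(\<Sum>v\<in>C. E (X k v)) = (real c - real k) * q k" for k
  proof -
    have "(\<Sum>v\<in>C. X k v R) = (real c - real k) * (\<Sum>K\<in>\<K>. real (card (R \<inter> K) choose k))" for R
    proof -
      have "(\<Sum>v\<in>K. real (card (R \<inter> (K - {v})) choose k)) = (real c - real k) * real (card (R \<inter> K) choose k)"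
        if "K \<in> \<K>" for K
      proof -
        let ?j = "card (R \<inter> K)"
        have "(\<Sum>v\<in>K. real (card (R \<inter> (K - {v})) choose k)) = (\<Sum>v\<in>K. real ((?j - of_bool (v \<in> R)) choose k))"
          using card_in finK[OF that] by (intro sum.cong) auto
        also have "\<dots> = real ?j * real ((?j - 1) choose k) + (real c - real ?j) * real (?j choose k)"
          using split[OF that, of "\<lambda>e. real ((?j - e) choose k)" R] by simp
        also have "\<dots> = (real c - real k) * real (?j choose k)"
          unfolding absorb' by (simp add: algebra_simps)
        finally show ?thesis .
      qed
      then show ?thesis unfolding sumX by (simp add: sum_distrib_left)
    qed
    then show ?thesis unfolding q_def by (simp flip: E_sum E_cmult)
  qed
  \<comment> \<open>For \<open>v\<close> in \<open>R\<close>, adding \<open>v\<close> to the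
    \<open>k\<close>-set gives a set of size \<open>k + 1\<close>, which arises from
    \<open>k + 1\<close> choices of \<open>v\<close>.\<close>
  have q_in: "(\<Sum>v\<in>C. E (\<lambda>R. of_bool (v \<in> R) * X k v R)) = (real k + 1) * q (Suc k)" for k
  proof -
    have "(\<Sum>v\<in>C. of_bool (v \<in> R) * X k v R) = (real k + 1) * (\<Sum>K\<in>\<K>. real (card (R \<inter> K) choose Suc k))" for R
    proof -
      have "(\<Sum>v\<in>K. of_bool (v \<in> R) * real (card (R \<inter> (K - {v})) choose k))
          = (real k + 1) * real (card (R \<inter> K) choose Suc k)" if "K \<in> \<K>" for K
      proof -
        let ?j = "card (R \<inter> K)"
        have "(\<Sum>v\<in>K. of_bool (v \<in> R) * real (card (R \<inter> (K - {v})) choose k))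
            = (\<Sum>v\<in>K. real (of_bool (v \<in> R)) * real ((?j - of_bool (v \<in> R)) choose k))"
          using card_in finK[OF that] by (intro sum.cong) auto
        also have "\<dots> = real ?j * real ((?j - 1) choose k)"
          using split[OF that, of "\<lambda>e. real e * real ((?j - e) choose k)" R] by simp
        finally show ?thesis by (simp only: absorb)
      qed
      then show ?thesis unfolding sumX' by (simp add: sum_distrib_left)
    qed
    then show ?thesis unfolding q_def by (simp flip: E_sum E_cmult)
  qed
  \<comment> \<open>Distinct members through \<open>v\<close> share only \<open>v\<close>, so their
    contributions factorise. On the diagonal, \<open>few\<close> bounds one of the two equal
    binomials by \<open>2 ^ (r - 1)\<close>.\<close>
  have second: "E (\<lambda>R. (X k v R)\<^sup>2) \<le> ((d v * b k)\<^sup>2 + 2 ^ (r - 1) * (d v * b k)) * Z" for k v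
  proof -
    let ?F = "{K\<in>\<K>. v \<in> K}"
    let ?f = "\<lambda>K R. real (card (R \<inter> (K - {v})) choose k)"
    have finF: "finite ?F" using K(1) by simp
    have cK: "card (K - {v}) = c - 1" "finite (K - {v})" if "K \<in> ?F" for K
      using that K(3) finK by (auto simp: card_Diff_singleton_if)
    have pair_le: "E (\<lambda>R. ?f K R * ?f K' R) \<le> (b k * b k + of_bool (K = K') * (2 ^ (r - 1) * b k)) * Z"
      if KK: "K \<in> ?F" "K' \<in> ?F" for K K'
    proof (cases "K = K'")
      case True
      have "E (\<lambda>R. ?f K R * ?f K' R) \<le> E (\<lambda>R. 2 ^ (r - 1) * ?f K R)"
      proof (rule E_mono)
        fix R assume R: "R \<in> \<R>"
        have "card (R \<inter> (K - {v})) \<le> card (R \<inter> K)" using KK finK by (intro card_mono) auto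
        then have "card (R \<inter> (K - {v})) \<le> r - 1" using few[OF R, of K] KK by auto
        then have "card (R \<inter> (K - {v})) choose k \<le> 2 ^ (r - 1)"
          using binomial_le_pow2[of "card (R \<inter> (K - {v}))" k]
          by (meson le_trans one_le_numeral power_increasing)
        then have "?f K R \<le> 2 ^ (r - 1)" by (metis of_nat_le_iff of_nat_numeral of_nat_power)
        then show "?f K R * ?f K' R \<le> 2 ^ (r - 1) * ?f K R"
          unfolding True[symmetric] by (intro mult_right_mono) auto
      qed
      also have "\<dots> = 2 ^ (r - 1) * E (?f K)" by (rule E_cmult)
      also have "\<dots> \<le> 2 ^ (r - 1) * (b k * Z)"
        using E_binomial_le[OF cK(2)[OF KK(1)], of k] cK(1)[OF KK(1)] by (simp add: b_def Z_def)
      also have "\<dots> \<le> (b k * b k + 2 ^ (r - 1) * b k) * Z"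
        using Z b0[of k] by (simp add: distrib_right)
      finally show ?thesis using True by simp
    next
      case False
      have "(K - {v}) \<inter> (K' - {v}) = {}"
      proof (rule ccontr)
        assume "\<not> ?thesis"
        then obtain w where "w \<noteq> v" "{v, w} \<subseteq> K \<inter> K'" using KK by auto
        then have "card {v, w} \<le> card (K \<inter> K')" using KK finK by (intro card_mono) auto
        with lin[of K K'] KK False \<open>w \<noteq> v\<close> show False by simp
      qed
      from E_binomial_prod_le[OF cK(2)[OF KK(1)] cK(2)[OF KK(2)] this, of k]
      show ?thesis using False cK(1) KK by (simp add: b_def Z_def)
    qed
    have "E (\<lambda>R. (X k v R)\<^sup>2) = (\<Sum>K\<in>?F. \<Sum>K'\<in>?F. E (\<lambda>R. ?f K R * ?f K' R))"
      unfolding X_def power2_eq_square sum_product by (simp only: E_sum)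
    also have "\<dots> \<le> (\<Sum>K\<in>?F. \<Sum>K'\<in>?F. (b k * b k + of_bool (K = K') * (2 ^ (r - 1) * b k)) * Z)"
      by (intro sum_mono pair_le)
    also have "\<dots> = (\<Sum>K\<in>?F. (d v * (b k * b k) + 2 ^ (r - 1) * b k) * Z)"
    proof (intro sum.cong refl)
      fix K assume "K \<in> ?F"
      then have "(\<Sum>K'\<in>?F. of_bool (K = K') * (2 ^ (r - 1) * b k)) = 2 ^ (r - 1) * b k"
        using finF by (subst sum.remove[where x=K]) (auto intro!: sum.neutral)
      then show "(\<Sum>K'\<in>?F. (b k * b k + of_bool (K = K') * (2 ^ (r - 1) * b k)) * Z)
          = (d v * (b k * b k) + 2 ^ (r - 1) * b k) * Z"
        unfolding sum_distrib_right[symmetric] sum.distrib by (simp add: d_def)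
    qed
    also have "\<dots> = ((d v * b k)\<^sup>2 + 2 ^ (r - 1) * (d v * b k)) * Z"
      by (simp add: d_def power2_eq_square algebra_simps)
    finally show ?thesis .
  qed
  \<comment> \<open>By \<open>E_insert\<close> the right side is \<open>t\<close> times the part of
    \<open>E (X k v)\<close> on faces to which \<open>v\<close> can be newly added. The part lost on
    the other faces is small, because these faces are rare and the second moment of \<open>X\<close>
    is controlled.\<close>
  have step: "t * E (X k v) - t * ((d v * b k + 2 ^ (r - 1)) / (real r + 1) * Z)
      \<le> E (\<lambda>R. of_bool (v \<in> R) * X k v R)" if v: "v \<in> C" for k v
  proof -
    let ?G = "\<lambda>R. v \<notin> R \<and> insert v R \<in> \<R>"
    define x where "x = d v * b k"
    note second' = second[of k v, folded x_def]
    have ins: "X k v (insert v R) = X k v R" for R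
      unfolding X_def by (intro sum.cong refl arg_cong2[where f="binomial"] arg_cong[where f=real] arg_cong[where f=card]) auto
    have x0: "x \<ge> 0" using b0 by (simp add: x_def d_def)
    have lost: "E (\<lambda>R. of_bool (\<not> ?G R) * X k v R) \<le> (x + 2 ^ (r - 1)) / (real r + 1) * Z"
    \<comment> \<open>The general case divides by \<open>x\<close>. For \<open>x = 0\<close> the
      second moment vanishes, hence so does \<open>X\<close> on every face.\<close>
    proof (cases "x = 0")
      case True
      have "E (\<lambda>R. (X k v R)\<^sup>2) \<le> 0" using second' True by simp
      then have "(\<Sum>R\<in>\<R>. t ^ card R * (X k v R)\<^sup>2) = 0"
        unfolding E_def using t_pos by (intro antisym sum_nonneg) auto
      then have "\<forall>R\<in>\<R>. t ^ card R * (X k v R)\<^sup>2 = 0"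
        using t_pos by (subst (asm) sum_nonneg_eq_0_iff[OF finite_R]) auto
      then have "\<forall>R\<in>\<R>. X k v R = 0" using t_pos by simp
      then have "E (\<lambda>R. of_bool (\<not> ?G R) * X k v R) = 0" unfolding E_def by simp
      also have "0 \<le> (x + 2 ^ (r - 1)) / (real r + 1) * Z"
        using Z x0 by (intro mult_nonneg_nonneg divide_nonneg_nonneg) auto
      finally show ?thesis .
    next
      case False
      then have xpos: "x > 0" using x0 by simp
      define \<rho> where "\<rho> = real r + 1"
      have \<rho>: "\<rho> > 0" by (simp add: \<rho>_def)
      have "E (\<lambda>R. of_bool (\<not> ?G R) * X k v R)
          \<le> E (\<lambda>R. (\<rho> * x / 2) * of_bool (\<not> ?G R) + (1 / (2 * \<rho> * x)) * (X k v R)\<^sup>2)"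
      proof (rule E_mono)
        fix R
        \<comment> \<open>This is AM-GM; the scale \<open>\<rho> * x\<close> balances the
          probability \<open>1 / \<rho>\<^sup>2\<close> that \<open>v\<close> is blocked against the
          second moment, which is about \<open>x\<^sup>2\<close>.\<close>
        have "0 \<le> (\<rho> * x - X k v R)\<^sup>2" by simp
        then have "2 * (\<rho> * x) * X k v R \<le> (\<rho> * x)\<^sup>2 + (X k v R)\<^sup>2"
          by (simp add: power2_diff)
        then have "X k v R \<le> ((\<rho> * x)\<^sup>2 + (X k v R)\<^sup>2) / (2 * (\<rho> * x))"
          using xpos \<rho> by (subst pos_le_divide_eq) (auto simp: mult_ac)
        also have "\<dots> = \<rho> * x / 2 + (1 / (2 * \<rho> * x)) * (X k v R)\<^sup>2"
          using xpos \<rho> by (simp add: field_simps power2_eq_square)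
        finally show "of_bool (\<not> ?G R) * X k v R
            \<le> (\<rho> * x / 2) * of_bool (\<not> ?G R) + (1 / (2 * \<rho> * x)) * (X k v R)\<^sup>2"
          using xpos \<rho> by (cases "?G R") auto
      qed
      also have "\<dots> = (\<rho> * x / 2) * E (\<lambda>R. of_bool (\<not> ?G R)) + (1 / (2 * \<rho> * x)) * E (\<lambda>R. (X k v R)\<^sup>2)"
        by (simp only: E_add E_cmult)
      also have "\<dots> \<le> (\<rho> * x / 2) * (Z / \<rho>\<^sup>2) + (1 / (2 * \<rho> * x)) * ((x\<^sup>2 + 2 ^ (r - 1) * x) * Z)"
        using free[OF v, folded \<rho>_def] second' xpos \<rho> by (intro add_mono mult_left_mono) (auto simp: Z_def)
      also have "\<dots> = (x + 2 ^ (r - 1) / 2) / \<rho> * Z"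
        using xpos \<rho> by (simp add: field_simps power2_eq_square)
      also have "\<dots> \<le> (x + 2 ^ (r - 1)) / \<rho> * Z"
        using Z \<rho> by (intro mult_right_mono divide_right_mono) auto
      finally show ?thesis by (simp add: \<rho>_def)
    qed
    have "E (\<lambda>R. of_bool (v \<in> R) * X k v R) = t * E (\<lambda>R. of_bool (?G R) * X k v R)"
      using E_insert[of v "X k v"] ins v C by blast
    moreover have "E (X k v) = E (\<lambda>R. of_bool (?G R) * X k v R) + E (\<lambda>R. of_bool (\<not> ?G R) * X k v R)"
      unfolding E_add[symmetric] by (intro E_cong) auto
    moreover have "t * E (\<lambda>R. of_bool (\<not> ?G R) * X k v R) \<le> t * ((x + 2 ^ (r - 1)) / (real r + 1) * Z)"
      using lost t_pos by (intro mult_left_mono) auto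
    ultimately show ?thesis unfolding x_def by (simp only: distrib_left)
  qed
  have sumd: "(\<Sum>v\<in>C. d v) = M * real c"
  proof -
    have "(\<Sum>v\<in>C. d v) = (\<Sum>v\<in>C. \<Sum>K\<in>{K\<in>\<K>. v \<in> K}. 1)" by (simp add: d_def)
    also have "\<dots> = (\<Sum>K\<in>\<K>. \<Sum>v\<in>{v\<in>C. v \<in> K}. 1)" using finC K(1) by (rule sum.swap_restrict)
    also have "\<dots> = (\<Sum>K\<in>\<K>. real c)"
    proof (intro sum.cong refl)
      fix K assume "K \<in> \<K>"
      then have "{v\<in>C. v \<in> K} = K" "card K = c" using K by auto
      then show "(\<Sum>v\<in>{v\<in>C. v \<in> K}. 1) = real c" by simp
    qed
    finally show ?thesis by (simp add: M_def)
  qed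
  \<comment> \<open>\<open>\<theta>\<close> equals \<open>(1 + 1 / (r + 1)) / (r + 1)\<close>, the
    relative loss in passing from \<open>k\<close> to \<open>k + 1\<close>. A total of
    \<open>r\<close> such losses stays below 1.\<close>
  define \<theta> where "\<theta> = (real r + 2) / (real r + 1)\<^sup>2"
  \<comment> \<open>The comparison value is the upper bound for \<open>q k\<close> that
    \<open>E_binomial_le\<close> gives, so the induction shows that this bound is nearly
    attained.\<close>
  have grow: "(1 - real k * \<theta>) * (Z * M * (real (c choose k) * t ^ k)) \<le> q k" if "k \<le> r" for k
    using that
  proof (induction k)
    case 0
    show ?case by (simp add: q_def Z_def M_def mult.commute flip: E_cmult)
  next
    case (Suc k)
    then have k: "k < r" by simp
    have cb: "real c * b k = (real c - real k) * (real (c choose k) * t ^ k)"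
      using absorb'[of c k] by (simp add: b_def)
    have "(real k + 1) * q (Suc k) \<ge> (\<Sum>v\<in>C. t * E (X k v) - t * ((d v * b k + 2 ^ (r - 1)) / (real r + 1) * Z))"
      unfolding q_in[symmetric] by (intro sum_mono step)
    also have "(\<Sum>v\<in>C. t * E (X k v) - t * ((d v * b k + 2 ^ (r - 1)) / (real r + 1) * Z))
       = t * (\<Sum>v\<in>C. E (X k v)) - t * (((\<Sum>v\<in>C. d v) * b k + real (card C) * 2 ^ (r - 1)) / (real r + 1) * Z)"
      by (simp add: sum_subtractf sum_distrib_left sum_distrib_right sum.distrib sum_divide_distrib[symmetric] add_divide_distrib distrib_left distrib_right)
    also have "\<dots> = t * ((real c - real k) * q k) - t * ((M * real c * b k + real (card C) * 2 ^ (r - 1)) / (real r + 1) * Z)"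
      by (simp only: q_out sumd)
    finally have 1: "t * ((real c - real k) * q k) - t * ((M * real c * b k + real (card C) * 2 ^ (r - 1)) / (real r + 1) * Z)
      \<le> (real k + 1) * q (Suc k)" .
    \<comment> \<open>Richness makes the contribution of the diagonal at most a fraction
      \<open>1 / (r + 1)\<close> of the main term.\<close>
    have "real (card C) * 2 ^ (r - 1) \<le> M * real c * b k / (real r + 1)"
      using rich[OF k] by (subst pos_le_divide_eq) (auto simp: M_def b_def mult_ac)
    then have "(M * real c * b k + real (card C) * 2 ^ (r - 1)) / (real r + 1) * Z
       \<le> (M * real c * b k + M * real c * b k / (real r + 1)) / (real r + 1) * Z"
      using Z by (intro mult_right_mono divide_right_mono) auto
    also have "\<dots> = \<theta> * (M * real c * b k) * Z"
    proof -
      have "real r + 1 \<noteq> 0" by linarith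
      then show ?thesis unfolding \<theta>_def by (simp add: field_simps power2_eq_square)
    qed
    also have "\<dots> = (real c - real k) * (\<theta> * (Z * M * (real (c choose k) * t ^ k)))"
    proof -
      have "\<theta> * (M * real c * b k) * Z = \<theta> * M * Z * (real c * b k)" by simp
      then show ?thesis unfolding cb by (simp add: mult_ac)
    qed
    finally have 2: "(M * real c * b k + real (card C) * 2 ^ (r - 1)) / (real r + 1) * Z
      \<le> (real c - real k) * (\<theta> * (Z * M * (real (c choose k) * t ^ k)))" .
    have 3: "(real c - real k) * q k \<ge> (real c - real k) * ((1 - real k * \<theta>) * (Z * M * (real (c choose k) * t ^ k)))"
      using Suc k rc by (intro mult_left_mono) auto
    have "t * ((real c - real k) * ((1 - real k * \<theta>) * (Z * M * (real (c choose k) * t ^ k)))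
          - (real c - real k) * (\<theta> * (Z * M * (real (c choose k) * t ^ k))))
        \<le> t * ((real c - real k) * q k - (M * real c * b k + real (card C) * 2 ^ (r - 1)) / (real r + 1) * Z)"
      by (intro mult_left_mono[OF diff_mono[OF 3 2]] less_imp_le[OF t_pos])
    also have "\<dots> \<le> (real k + 1) * q (Suc k)" using 1 by (simp add: right_diff_distrib)
    finally have 4: "t * ((real c - real k) * ((1 - real k * \<theta>) * (Z * M * (real (c choose k) * t ^ k)))
          - (real c - real k) * (\<theta> * (Z * M * (real (c choose k) * t ^ k)))) \<le> (real k + 1) * q (Suc k)" .
    have e: "(real c - real k) * real (c choose k) = (real k + 1) * real (c choose Suc k)"
      using absorb[of c k] absorb'[of c k] by simp
    have "t * ((real c - real k) * ((1 - real k * \<theta>) * (Z * M * (real (c choose k) * t ^ k)))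
          - (real c - real k) * (\<theta> * (Z * M * (real (c choose k) * t ^ k))))
        = (1 - real (Suc k) * \<theta>) * (Z * M * t ^ Suc k) * ((real c - real k) * real (c choose k))"
      by (simp add: algebra_simps)
    also have "\<dots> = (real k + 1) * ((1 - real (Suc k) * \<theta>) * (Z * M * (real (c choose Suc k) * t ^ Suc k)))"
      unfolding e by (simp only: mult_ac)
    finally have "t * ((real c - real k) * ((1 - real k * \<theta>) * (Z * M * (real (c choose k) * t ^ k)))
          - (real c - real k) * (\<theta> * (Z * M * (real (c choose k) * t ^ k))))
        = (real k + 1) * ((1 - real (Suc k) * \<theta>) * (Z * M * (real (c choose Suc k) * t ^ Suc k)))" .
    with 4 have "(real k + 1) * ((1 - real (Suc k) * \<theta>) * (Z * M * (real (c choose Suc k) * t ^ Suc k)))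
        \<le> (real k + 1) * q (Suc k)" by (simp only:)
    then show ?case by (subst (asm) mult_le_cancel_left_pos) auto
  qed
  have \<theta>: "real r * \<theta> < 1"
  proof -
    have "real r * (real r + 2) < (real r + 1)\<^sup>2" by (simp add: power2_eq_square algebra_simps)
    then show ?thesis unfolding \<theta>_def by simp
  qed
  have "Z * M * (real (c choose r) * t ^ r) > 0"
    using Z Mpos rc t_pos by simp
  with \<theta> have "0 < (1 - real r * \<theta>) * (Z * M * (real (c choose r) * t ^ r))"
    using mult_pos_pos[of "1 - real r * \<theta>"] by (simp only: diff_gt_0_iff_gt)
  also have "\<dots> \<le> q r" by (rule grow) simp
  finally have "q r > 0" .
  \<comment> \<open>Under \<open>few\<close> every binomial with lower index \<open>r\<close> is
    zero, so \<open>q r\<close> would be both positive and zero.\<close>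
  moreover have "q r = E (\<lambda>R. 0)"
    unfolding q_def using few by (intro E_cong sum.neutral) (auto simp: binomial_eq_0)
  ultimately show False by (simp add: E_def)
qed

end

section \<open>Extending independent sets in a net of lines\<close>

text \<open>The incidence properties of a cube on which the counting rests. \<open>line i v\<close>
  is the line of direction \<open>i\<close> through \<open>v\<close>; the lines of one direction
  partition \<open>\<Omega>\<close>, and lines of different directions through a point meet only
  there.\<close>

locale net =
  fixes \<Omega> :: "'a set" and I :: "'i set" and line :: "'i \<Rightarrow> 'a \<Rightarrow> 'a set" and n r :: nat
  assumes finite_points: "finite \<Omega>" and points_nonempty: "\<Omega> \<noteq> {}" and finite_dirs: "finite I"
    and line_sub: "\<And>i v. i \<in> I \<Longrightarrow> v \<in> \<Omega> \<Longrightarrow> line i v \<subseteq> \<Omega>"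
    and line_self: "\<And>i v. i \<in> I \<Longrightarrow> v \<in> \<Omega> \<Longrightarrow> v \<in> line i v"
    and line_card: "\<And>i v. i \<in> I \<Longrightarrow> v \<in> \<Omega> \<Longrightarrow> card (line i v) = n"
    and line_eq: "\<And>i v w. i \<in> I \<Longrightarrow> v \<in> \<Omega> \<Longrightarrow> w \<in> line i v \<Longrightarrow> line i w = line i v"
    and line_inter: "\<And>i j v. i \<in> I \<Longrightarrow> j \<in> I \<Longrightarrow> i \<noteq> j \<Longrightarrow> v \<in> \<Omega> \<Longrightarrow> line i v \<inter> line j v = {v}"
    and r_pos: "0 < r"
begin

section \<open>Independent sets and their partition function\<close>

definition indep :: "'a set \<Rightarrow> bool" where
  "indep A \<longleftrightarrow> (\<forall>i\<in>I. \<forall>v\<in>\<Omega>. card (A \<inter> line i v) < r)"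

text \<open>The set \<open>R\<close> may overlap \<open>S\<close>, so a point of \<open>S\<close> in
  \<open>\<Omega>\<close> can be put into \<open>R\<close> or removed from it freely. This is the
  source of the factor \<open>1 + t\<close> in \<open>Z_insert_eq\<close>.\<close>

definition faces :: "'a set \<Rightarrow> 'a set set" where
  "faces S = {R. R \<subseteq> \<Omega> \<and> indep (R \<union> S)}"

definition Z :: "real \<Rightarrow> 'a set \<Rightarrow> real" where
  "Z t S = (\<Sum>R\<in>faces S. t ^ card R)"

lemma finite_line: "i \<in> I \<Longrightarrow> v \<in> \<Omega> \<Longrightarrow> finite (line i v)"
  using line_sub finite_points finite_subset by blast

lemma indep_mono:
  assumes "indep A" "B \<subseteq> A"
  shows "indep B"
  unfolding indep_def
proof (intro ballI)
  fix i v assume iv: "i \<in> I" "v \<in> \<Omega>"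
  have "card (B \<inter> line i v) \<le> card (A \<inter> line i v)"
    using assms finite_line[OF iv] by (intro card_mono) auto
  then show "card (B \<inter> line i v) < r" using assms iv unfolding indep_def by fastforce
qed

lemma faces_weighted_complex:
  assumes "indep S" "t > 0"
  shows "weighted_complex \<Omega> (faces S) t"
proof
  fix R R' assume "R \<in> faces S" "R' \<subseteq> R"
  then show "R' \<in> faces S" unfolding faces_def using indep_mono[of "R \<union> S" "R' \<union> S"] by blast
qed (use assms finite_points in \<open>auto simp: faces_def\<close>)

lemma finite_faces: "finite (faces S)"
  unfolding faces_def using finite_points by simp

lemma Z_nonneg: "t > 0 \<Longrightarrow> Z t S \<ge> 0"
  unfolding Z_def by (intro sum_nonneg) auto

lemma Z_eq_0: "\<not> indep S \<Longrightarrow> Z t S = 0"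
  unfolding Z_def faces_def using indep_mono by (intro sum.neutral) auto

lemma Z_ge_1:
  assumes "indep S" "t > 0"
  shows "Z t S \<ge> 1"
proof -
  interpret weighted_complex \<Omega> "faces S" t by (rule faces_weighted_complex[OF assms])
  show ?thesis using E_one_ge_1 by (simp add: E_def Z_def)
qed

lemma Z_insert_le:
  assumes "t > 0"
  shows "Z t (insert v S) \<le> Z t S"
proof -
  have "faces (insert v S) \<subseteq> faces S"
    unfolding faces_def using indep_mono[of "R \<union> insert v S" "R \<union> S" for R] by blast
  then show ?thesis unfolding Z_def using assms finite_faces by (intro sum_mono2) auto
qed

lemma Z_empty_le:
  assumes "t > 0"
  shows "Z t {} \<le> (1 + t) ^ card \<Omega>"
proof -
  have "Z t {} \<le> (\<Sum>R\<in>Pow \<Omega>. t ^ card R)"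
    unfolding Z_def using assms finite_points by (intro sum_mono2) (auto simp: faces_def)
  also have "\<dots> = (\<Sum>R\<in>Pow \<Omega>. (\<Prod>x\<in>R. t) * (\<Prod>x\<in>\<Omega> - R. 1))" by simp
  also have "\<dots> = (\<Prod>x\<in>\<Omega>. t + 1)" using finite_points by (rule prod_add[symmetric])
  finally show ?thesis by (simp add: add.commute)
qed

text \<open>A face of \<open>insert v S\<close> stays one when \<open>v\<close> is added or removed,
  so these faces come in pairs whose weights have ratio \<open>t\<close>. Hence
  \<open>Z t (insert v S) / ((1 + t) * Z t S)\<close> is the probability that \<open>v\<close> can
  be newly added to a random face of \<open>S\<close>.\<close>

lemma Z_insert_eq:
  assumes v: "v \<in> \<Omega>" and S: "indep S" and t: "t > 0"
  shows "Z t (insert v S) = (1 + t) * weighted_complex.E (faces S) t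
           (\<lambda>R. of_bool (v \<notin> R \<and> insert v R \<in> faces S))"
proof -
  interpret weighted_complex \<Omega> "faces S" t by (rule faces_weighted_complex[OF S t])
  let ?G = "{R\<in>faces S. v \<notin> R \<and> insert v R \<in> faces S}"
  have split: "faces (insert v S) = ?G \<union> insert v ` ?G"
  proof (intro equalityI subsetI)
    fix R assume R: "R \<in> faces (insert v S)"
    then have "insert v R \<in> faces S" using v by (auto simp: faces_def)
    then have *: "R - {v} \<in> faces S" "insert v (R - {v}) \<in> faces S"
      using down[of "insert v R"] by (auto simp: insert_absorb)
    show "R \<in> ?G \<union> insert v ` ?G"
    proof (cases "v \<in> R")
      case True
      then have "R = insert v (R - {v})" by blast
      then show ?thesis using * by blast
    next
      case False
      then show ?thesis using * by simp
    qed
  next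
    fix R assume "R \<in> ?G \<union> insert v ` ?G"
    then show "R \<in> faces (insert v S)" by (auto simp: faces_def)
  qed
  have "Z t (insert v S) = (\<Sum>R\<in>?G. t ^ card R) + (\<Sum>R\<in>insert v ` ?G. t ^ card R)"
    unfolding Z_def split using finite_faces by (intro sum.union_disjoint) auto
  also have "(\<Sum>R\<in>insert v ` ?G. t ^ card R) = (\<Sum>R\<in>?G. t * t ^ card R)"
    using finite_mem by (subst sum.reindex) (auto intro!: inj_onI sum.cong dest: insert_ident[THEN iffD1, rotated 2])
  also have "(\<Sum>R\<in>?G. t ^ card R) + \<dots> = (1 + t) * (\<Sum>R\<in>?G. t ^ card R)"
    by (simp add: sum_distrib_left distrib_right sum.distrib)
  also have "(\<Sum>R\<in>?G. t ^ card R) = E (\<lambda>R. of_bool (v \<notin> R \<and> insert v R \<in> faces S))"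
    unfolding E_def using finite_faces by (intro sum.mono_neutral_cong_left) auto
  finally show ?thesis .
qed

section \<open>Linearity of the family of lines and incidence counting\<close>

lemma lines_linear:
  assumes "i \<in> I" "j \<in> I" "v \<in> \<Omega>" "w \<in> \<Omega>" "line i v \<noteq> line j w"
  shows "card (line i v \<inter> line j w) \<le> 1"
proof (cases "line i v \<inter> line j w = {}")
  case False
  then obtain u where u: "u \<in> line i v" "u \<in> line j w" by blast
  then have e: "line i u = line i v" "line j u = line j w" "u \<in> \<Omega>"
    using line_eq line_sub assms by blast+
  then have "i \<noteq> j" using assms by auto
  then show ?thesis using line_inter[OF assms(1,2) _ e(3)] e by simp
qed simp

definition lines :: "'a set set" where
  "lines = (\<lambda>(i, v). line i v) ` (I \<times> \<Omega>)"

lemma finite_lines: "finite lines"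
  unfolding lines_def using finite_dirs finite_points by simp

lemma linesE:
  assumes "l \<in> lines"
  obtains i v where "i \<in> I" "v \<in> \<Omega>" "l = line i v"
  using assms unfolding lines_def by auto

text \<open>Each point lies on one line per direction, and \<open>2 \<le> n\<close> makes these
  lines distinct as sets, so each point contributes \<open>card I\<close>.\<close>

lemma incidences:
  assumes "C \<subseteq> \<Omega>" "2 \<le> n"
  shows "(\<Sum>l\<in>lines. card (l \<inter> C)) = card I * card C"
proof -
  have finC: "finite C" using assms finite_points finite_subset by blast
  have "(\<Sum>l\<in>lines. card (l \<inter> C)) = (\<Sum>l\<in>lines. \<Sum>v\<in>{v\<in>C. v \<in> l}. 1)"
    by (intro sum.cong refl) (simp add: Int_def conj_commute)
  also have "\<dots> = (\<Sum>v\<in>C. \<Sum>l\<in>{l\<in>lines. v \<in> l}. 1)"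
    using finite_lines finC by (rule sum.swap_restrict)
  also have "\<dots> = (\<Sum>v\<in>C. card I)"
  proof (intro sum.cong refl)
    fix v assume "v \<in> C"
    then have v: "v \<in> \<Omega>" using assms by blast
    have "{l\<in>lines. v \<in> l} = (\<lambda>i. line i v) ` I"
    proof (intro equalityI subsetI)
      fix l assume "l \<in> {l\<in>lines. v \<in> l}"
      then obtain i w where "i \<in> I" "w \<in> \<Omega>" "l = line i w" "v \<in> line i w" by (auto elim: linesE)
      then have "l = line i v" using line_eq[of i w v] by simp
      then show "l \<in> (\<lambda>i. line i v) ` I" using \<open>i \<in> I\<close> by blast
    qed (use v line_self in \<open>auto simp: lines_def\<close>)
    moreover have "inj_on (\<lambda>i. line i v) I"
    proof (rule inj_onI, rule ccontr)
      fix i j assume ij: "i \<in> I" "j \<in> I" "line i v = line j v" "i \<noteq> j"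
      then have "line i v = {v}" using line_inter v by blast
      then show False using line_card[of i v] ij v assms by simp
    qed
    ultimately show "(\<Sum>l\<in>{l\<in>lines. v \<in> l}. 1) = card I" by (simp add: card_image)
  qed
  finally show ?thesis by simp
qed

text \<open>By \<open>Z_insert_eq\<close> each point of the set is addable to a random face with
  probability at least \<open>1 - 1 / (r + 1)^2\<close>. If such points made up an eighth of
  \<open>\<Omega>\<close>, the lines rich in them would satisfy
  \<open>linear_family_meets_face\<close>, and some face would have \<open>r\<close> points on a
  line, contrary to independence.\<close>

lemma few_extendable:
  fixes t :: real and c :: nat
  assumes S: "indep S" and t: "t > 0" and nc: "n = 16 * c" and c: "2 \<le> c" "r \<le> c"
    and rich: "\<And>k. k < r \<Longrightarrow> 32 * (real r + 1) * 2 ^ (r - 1) \<le> real (card I) * (real ((c - 1) choose k) * t ^ k)"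
  shows "8 * card {v\<in>\<Omega>. (1 + t) * (1 - 1 / (real r + 1)\<^sup>2) * Z t S \<le> Z t (insert v S)} < card \<Omega>"
proof (rule ccontr)
  interpret weighted_complex \<Omega> "faces S" t by (rule faces_weighted_complex[OF S t])
  define C where "C = {v\<in>\<Omega>. (1 + t) * (1 - 1 / (real r + 1)\<^sup>2) * Z t S \<le> Z t (insert v S)}"
  assume "\<not> ?thesis"
  then have big: "card \<Omega> \<le> 8 * card C" unfolding C_def by simp
  have C: "C \<subseteq> \<Omega>" unfolding C_def by auto
  then have finC: "finite C" using finite_points finite_subset by blast
  have "card \<Omega> > 0" using points_nonempty finite_points by (simp add: card_gt_0_iff)
  then have C0: "C \<noteq> {}" using big by (metis card.empty leD mult_0_right)
  define L where "L = {l\<in>lines. c \<le> card (l \<inter> C)}"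
  \<comment> \<open>The rich lines are cut down to a common size \<open>c\<close>, as the uniform
    family requires. The pieces stay distinct because lines share at most one point and
    \<open>2 \<le> c\<close>.\<close>
  define cl where "cl l = (SOME K. K \<subseteq> l \<inter> C \<and> card K = c)" for l
  have cl: "cl l \<subseteq> l \<inter> C \<and> card (cl l) = c" if "l \<in> L" for l
  proof -
    have "c \<le> card (l \<inter> C)" using that unfolding L_def by simp
    then obtain K where "K \<subseteq> l \<inter> C" "card K = c" by (rule obtain_subset_with_card_n)
    then have "\<exists>K. K \<subseteq> l \<inter> C \<and> card K = c" by blast
    then show ?thesis unfolding cl_def by (rule someI_ex)
  qed
  have lin: "card (l \<inter> l') \<le> 1" if "l \<in> L" "l' \<in> L" "l \<noteq> l'" for l l'
  proof -
    have "l \<in> lines" "l' \<in> lines" using that unfolding L_def by auto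
    then show ?thesis using that(3) lines_linear by (metis linesE)
  qed
  have fin: "finite l" if "l \<in> L" for l using that finite_line unfolding L_def by (auto elim!: linesE)
  have inj: "inj_on cl L"
  proof (rule inj_onI, rule ccontr)
    fix l l' assume l: "l \<in> L" "l' \<in> L" "cl l = cl l'" "l \<noteq> l'"
    then have "cl l \<subseteq> l \<inter> l'" using cl by blast
    then have "c \<le> card (l \<inter> l')" using cl[OF l(1)] fin[OF l(1)] card_mono[of "l \<inter> l'" "cl l"] by simp
    then show False using lin[OF l(1,2,4)] c by simp
  qed
  \<comment> \<open>On average a line meets \<open>C\<close> in at least
    \<open>n / 8 = 2 * c\<close> points, so lines with fewer than \<open>c\<close> of them carry at
    most half of the incidences. Each remaining line carries at most \<open>16 * c\<close>, whence
    the factor 32.\<close>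
  have many: "real (card I) * real (card C) \<le> 32 * (real (card (cl ` L)) * real c)"
  proof -
    have "card lines * n = (\<Sum>l\<in>lines. card (l \<inter> \<Omega>))"
    proof -
      have "card (l \<inter> \<Omega>) = n" if "l \<in> lines" for l
        using that line_sub line_card by (metis Int_absorb2 linesE)
      then show ?thesis by simp
    qed
    also have "\<dots> = card I * card \<Omega>" using nc c by (intro incidences) auto
    finally have "card lines * n = card I * card \<Omega>" .
    then have "card lines * (16 * c) \<le> card I * (8 * card C)"
      unfolding nc using mult_le_mono2[OF big, of "card I"] by (simp only:)
    then have total: "2 * (card lines * c) \<le> card I * card C" by linarith
    have "card I * card C = (\<Sum>l\<in>lines. card (l \<inter> C))" using C nc c by (intro incidences[symmetric]) auto
    also have "\<dots> \<le> (\<Sum>l\<in>lines. c + (if l \<in> L then n else 0))"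
    proof (rule sum_mono)
      fix l assume l: "l \<in> lines"
      then have "card (l \<inter> C) \<le> n"
        by (metis card_mono finite_line inf_le1 line_card linesE)
      then show "card (l \<inter> C) \<le> c + (if l \<in> L then n else 0)" using l unfolding L_def by auto
    qed
    also have "\<dots> = card lines * c + card L * n"
    proof -
      have "lines \<inter> L = L" unfolding L_def by blast
      then show ?thesis using finite_lines by (simp add: sum.distrib sum.If_cases Int_def[symmetric])
    qed
    finally have "card I * card C \<le> card lines * c + card L * n" .
    then have "card I * card C \<le> 2 * (card L * n)" using total by linarith
    also have "\<dots> = 32 * (card (cl ` L) * c)" using nc inj by (simp add: card_image)
    finally show ?thesis by (metis of_nat_le_iff of_nat_mult of_nat_numeral)
  qed
  have "\<exists>R\<in>faces S. \<exists>K\<in>cl ` L. card (R \<inter> K) \<ge> r"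
  proof (rule linear_family_meets_face[OF C C0, where c=c])
    show "finite (cl ` L)" unfolding L_def using finite_lines by simp
    show "K \<subseteq> C" "card K = c" if "K \<in> cl ` L" for K using that cl by auto
    show "card (K \<inter> K') \<le> 1" if K: "K \<in> cl ` L" "K' \<in> cl ` L" "K \<noteq> K'" for K K'
    proof -
      obtain l l' where l: "l \<in> L" "l' \<in> L" "K = cl l" "K' = cl l'" using K by blast
      then have "card (K \<inter> K') \<le> card (l \<inter> l')"
        using cl[OF l(1)] cl[OF l(2)] fin[OF l(1)] by (intro card_mono) auto
      then show ?thesis using lin[of l l'] l K by force
    qed
    show "E (\<lambda>R. of_bool (\<not> (v \<notin> R \<and> insert v R \<in> faces S))) \<le> E (\<lambda>_. 1) / (real r + 1)\<^sup>2" if "v \<in> C" for v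
    proof -
      let ?G = "\<lambda>R. v \<notin> R \<and> insert v R \<in> faces S"
      have v: "v \<in> \<Omega>" "(1 + t) * (1 - 1 / (real r + 1)\<^sup>2) * Z t S \<le> Z t (insert v S)"
        using that unfolding C_def by auto
      have "(1 + t) * ((1 - 1 / (real r + 1)\<^sup>2) * Z t S) \<le> (1 + t) * E (\<lambda>R. of_bool (?G R))"
        using v(2) unfolding Z_insert_eq[OF v(1) S t] mult.assoc .
      then have 1: "(1 - 1 / (real r + 1)\<^sup>2) * Z t S \<le> E (\<lambda>R. of_bool (?G R))"
        by (rule mult_left_le_imp_le) (use t in simp)
      have 2: "E (\<lambda>_. 1) = E (\<lambda>R. of_bool (?G R)) + E (\<lambda>R. of_bool (\<not> ?G R))"
        unfolding E_add[symmetric] by (intro E_cong) auto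
      have 3: "Z t S = E (\<lambda>_. 1)" by (simp add: Z_def E_def)
      have "(1 - 1 / (real r + 1)\<^sup>2) * Z t S = E (\<lambda>_. 1) - E (\<lambda>_. 1) / (real r + 1)\<^sup>2"
        unfolding 3 by (simp add: left_diff_distrib)
      then show ?thesis using 1 2 by linarith
    qed
    show "(real r + 1) * 2 ^ (r - 1) * real (card C)
        \<le> real (card (cl ` L)) * real c * (real ((c - 1) choose k) * t ^ k)" if "k < r" for k
    proof -
      define A B where "A = (real r + 1) * 2 ^ (r - 1)" and "B = real ((c - 1) choose k) * t ^ k"
      have "32 * A \<le> real (card I) * B"
        using rich[OF that] unfolding A_def B_def by (simp only: mult.assoc)
      then have "32 * A * real (card C) \<le> (real (card I) * B) * real (card C)"
        by (rule mult_right_mono) simp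
      also have "\<dots> = (real (card I) * real (card C)) * B" by (simp only: mult_ac)
      also have "\<dots> \<le> (32 * (real (card (cl ` L)) * real c)) * B"
        using t by (intro mult_right_mono[OF many]) (simp add: B_def)
      finally have "A * real (card C) \<le> real (card (cl ` L)) * real c * B" by linarith
      then show ?thesis unfolding A_def B_def .
    qed
    show "0 < r" "r \<le> c" by (fact r_pos, fact c(2))
  qed
  then obtain R l where R: "R \<in> faces S" "l \<in> L" "card (R \<inter> cl l) \<ge> r" by blast
  have "l \<in> lines" using R(2) unfolding L_def by simp
  then obtain i v where l: "i \<in> I" "v \<in> \<Omega>" "l = line i v" by (rule linesE)
  have "R \<inter> cl l \<subseteq> (R \<union> S) \<inter> l" using cl[OF R(2)] by blast
  then have "card (R \<inter> cl l) \<le> card ((R \<union> S) \<inter> l)"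
    using fin[OF R(2)] by (intro card_mono) simp_all
  moreover have "card ((R \<union> S) \<inter> l) < r" using R(1) l unfolding faces_def indep_def by simp
  ultimately show False using R(3) by simp
qed

end

section \<open>Counting two-colourable sequences\<close>

context net
begin

text \<open>For fewer than one eighth of the points only monotonicity of \<open>Z\<close> is
  available. For the others \<open>Z\<close> shrinks by a factor whose \<open>a\<close>-th power is
  at most 1/16, and 1/8 + 1/16 = 3/16. The exponent \<open>a\<close> turns a slight decrease into a
  constant one.\<close>

lemma sum_Z_insert_le:
  fixes t :: real and c :: nat
  assumes t: "t > 0" "t \<le> 1 / (2 * (real r + 1)\<^sup>2)" and nc: "n = 16 * c" and c: "2 \<le> c" "r \<le> c"
    and rich: "\<And>k. k < r \<Longrightarrow> 32 * (real r + 1) * 2 ^ (r - 1) \<le> real (card I) * (real ((c - 1) choose k) * t ^ k)"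
    and a: "a = 8 * (r + 1)\<^sup>2"
  shows "(\<Sum>v\<in>\<Omega>. Z t (insert v S) ^ a) \<le> 3 / 16 * real (card \<Omega>) * Z t S ^ a"
proof (cases "indep S")
  case False
  then have "\<not> indep (insert v S)" for v using indep_mono by blast
  \<comment> \<open>For dependent \<open>S\<close> both sides should be zero; a positive exponent
    rules out \<open>0 ^ 0 = 1\<close>.\<close>
  moreover have "a > 0" using a by simp
  ultimately show ?thesis using False by (simp add: Z_eq_0 zero_power)
next
  case True
  define \<delta> where "\<delta> = 1 / (real r + 1)\<^sup>2"
  have \<delta>: "0 < \<delta>" "\<delta> \<le> 1" unfolding \<delta>_def by (simp_all add: add_nonneg_pos)
  define C where "C = {v\<in>\<Omega>. (1 + t) * (1 - \<delta>) * Z t S \<le> Z t (insert v S)}"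
  have C: "8 * card C < card \<Omega>"
    unfolding C_def \<delta>_def by (rule few_extendable[OF True t(1) nc c rich])
  \<comment> \<open>The bound \<open>t \<le> \<delta> / 2\<close> leaves a factor
    \<open>exp (- (\<delta> / 2))\<close>, and \<open>a\<close> is chosen so that its
    \<open>a\<close>-th power is \<open>exp (-4)\<close>.\<close>
  have small: "((1 + t) * (1 - \<delta>)) ^ a \<le> 1 / 16"
  proof -
    have "1 - \<delta> \<le> exp (- \<delta>)" using exp_ge_add_one_self[of "- \<delta>"] by simp
    then have "(1 + t) * (1 - \<delta>) \<le> exp t * exp (- \<delta>)"
      using exp_ge_add_one_self[of t] \<delta> t by (intro mult_mono) auto
    also have "\<dots> = exp (t - \<delta>)" by (simp add: exp_diff exp_minus field_simps)
    also have "\<dots> \<le> exp (- (\<delta> / 2))" using t unfolding \<delta>_def by simp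
    finally have "((1 + t) * (1 - \<delta>)) ^ a \<le> exp (- (\<delta> / 2)) ^ a"
      using \<delta> t by (intro power_mono) auto
    also have "\<dots> = exp (real a * (- (\<delta> / 2)))" by (rule exp_of_nat_mult[symmetric])
    also have "real a * (- (\<delta> / 2)) = real 4 * (- 1)"
    proof -
      have "real a = 8 * (real r + 1)\<^sup>2" unfolding a by (simp add: add.commute)
      moreover have "(real r + 1)\<^sup>2 \<noteq> 0" by (simp add: add_nonneg_eq_0_iff)
      ultimately show ?thesis unfolding \<delta>_def by simp
    qed
    also have "exp (real 4 * (- 1)) = (1 / exp 1) ^ 4"
      by (subst exp_of_nat_mult) (simp add: exp_minus field_simps)
    also have "\<dots> \<le> (1 / 2) ^ 4" using exp_ge_add_one_self[of 1] by (intro power_mono divide_left_mono) auto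
    finally show ?thesis by (simp add: power_divide)
  qed
  have Z0: "Z t S \<ge> 0" "Z t (insert v S) \<ge> 0" for v using Z_nonneg t by auto
  have "(\<Sum>v\<in>\<Omega>. Z t (insert v S) ^ a) \<le> (\<Sum>v\<in>\<Omega>. (if v \<in> C then Z t S ^ a else 0) + 1 / 16 * Z t S ^ a)"
  proof (rule sum_mono)
    fix v assume v: "v \<in> \<Omega>"
    show "Z t (insert v S) ^ a \<le> (if v \<in> C then Z t S ^ a else 0) + 1 / 16 * Z t S ^ a"
    proof (cases "v \<in> C")
      case True
      have "Z t (insert v S) ^ a \<le> Z t S ^ a" using Z0 Z_insert_le[OF t(1)] by (intro power_mono) auto
      moreover have "0 \<le> Z t S ^ a" using Z0 by simp
      ultimately show ?thesis using True by simp
    next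
      case False
      then have "Z t (insert v S) \<le> (1 + t) * (1 - \<delta>) * Z t S" using v unfolding C_def by simp
      then have "Z t (insert v S) ^ a \<le> ((1 + t) * (1 - \<delta>) * Z t S) ^ a"
        using Z0 by (intro power_mono) auto
      also have "\<dots> = ((1 + t) * (1 - \<delta>)) ^ a * Z t S ^ a" by (rule power_mult_distrib)
      also have "\<dots> \<le> 1 / 16 * Z t S ^ a" using Z0 by (intro mult_right_mono small) auto
      finally show ?thesis using False by simp
    qed
  qed
  also have "\<dots> = (real (card C) + real (card \<Omega>) / 16) * Z t S ^ a"
  proof -
    have "\<Omega> \<inter> C = C" unfolding C_def by blast
    then show ?thesis using finite_points by (simp add: sum.distrib sum.If_cases Int_def[symmetric] algebra_simps)
  qed
  also have "\<dots> \<le> (3 / 16 * real (card \<Omega>)) * Z t S ^ a"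
    using C Z0 by (intro mult_right_mono) auto
  finally show ?thesis .
qed

text \<open>\<open>wt xs S\<^sub>0 S\<^sub>1\<close> counts the ways to split the entries of \<open>xs\<close> into two colour classes, extending
  \<open>S\<^sub>0\<close> and \<open>S\<^sub>1\<close> to independent sets, and discarded entries, each of which costs a factor \<open>1/8\<close>.\<close>

primrec wt :: "'a list \<Rightarrow> 'a set \<Rightarrow> 'a set \<Rightarrow> real" where
  "wt [] S0 S1 = of_bool (indep S0 \<and> indep S1)"
| "wt (x # xs) S0 S1 = wt xs (insert x S0) S1 + wt xs S0 (insert x S1) + 1 / 8 * wt xs S0 S1"

lemma wt_nonneg: "wt xs S0 S1 \<ge> 0"
  by (induction xs arbitrary: S0 S1) auto

text \<open>A single branch of the recursion suffices: an entry goes to the first class if it lies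
  in \<open>A0\<close>, otherwise to the second if it lies in \<open>A1\<close>, and is otherwise
  discarded. All other branches are nonnegative.\<close>

lemma wt_ge:
  assumes "indep A0" "indep A1" "S0 \<subseteq> A0" "S1 \<subseteq> A1"
  shows "(1 / 8) ^ length (filter (\<lambda>x. x \<notin> A0 \<union> A1) xs) \<le> wt xs S0 S1"
  using assms(3,4)
proof (induction xs arbitrary: S0 S1)
  case Nil
  then show ?case using assms indep_mono by auto
next
  case (Cons x xs)
  have nn: "wt xs (insert x S0) S1 \<ge> 0" "wt xs S0 (insert x S1) \<ge> 0" "wt xs S0 S1 \<ge> 0"
    by (rule wt_nonneg)+
  consider "x \<in> A0" | "x \<in> A1" "x \<notin> A0" | "x \<notin> A0 \<union> A1" by blast
  then show ?case
  proof cases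
    case 1
    then show ?thesis using Cons.IH[of "insert x S0" S1] Cons.prems nn by auto
  next
    case 2
    then show ?thesis using Cons.IH[of S0 "insert x S1"] Cons.prems nn by auto
  next
    case 3
    then show ?thesis using Cons.IH[of S0 S1] Cons.prems nn by auto
  qed
qed

text \<open>\<open>Z t S0 ^ a * Z t S1 ^ a\<close> is a potential: averaged over the next entry, the
  two colours contribute 3/16 each and discarding contributes 1/8, in total 1/2. At the end it
  dominates the indicator, because \<open>Z\<close> is at least 1 on independent sets.\<close>

lemma sum_wt_le:
  fixes t :: real
  assumes t: "t > 0"
    and step: "\<And>S. (\<Sum>v\<in>\<Omega>. Z t (insert v S) ^ a) \<le> 3 / 16 * real (card \<Omega>) * Z t S ^ a"
  shows "(\<Sum>xs\<in>{xs. set xs \<subseteq> \<Omega> \<and> length xs = m}. wt xs S0 S1) \<le> Z t S0 ^ a * Z t S1 ^ a * (real (card \<Omega>) / 2) ^ m"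
proof (induction m arbitrary: S0 S1)
  case 0
  have e: "{xs. set xs \<subseteq> \<Omega> \<and> length xs = 0} = {[]}" by auto
  have Z0: "Z t S \<ge> 0" for S using Z_nonneg t by auto
  show ?case
  proof (cases "indep S0 \<and> indep S1")
    case True
    have "1 * 1 \<le> Z t S0 ^ a * Z t S1 ^ a"
      using True Z_ge_1[OF _ t] by (intro mult_mono one_le_power) (auto simp: Z0)
    then show ?thesis unfolding e using True by simp
  next
    case False
    then show ?thesis unfolding e using Z0 by (auto simp: mult_nonneg_nonneg)
  qed
next
  case (Suc m)
  let ?T = "{xs. set xs \<subseteq> \<Omega> \<and> length xs = m}" and ?N = "real (card \<Omega>)"
  have Z0: "Z t S \<ge> 0" for S using Z_nonneg t by auto
  have "(\<Sum>xs\<in>{xs. set xs \<subseteq> \<Omega> \<and> length xs = Suc m}. wt xs S0 S1) = (\<Sum>(xs, x)\<in>?T \<times> \<Omega>. wt (x # xs) S0 S1)"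
    unfolding lists_length_Suc_eq by (subst sum.reindex) (auto simp: inj_on_def case_prod_unfold)
  also have "\<dots> = (\<Sum>x\<in>\<Omega>. \<Sum>xs\<in>?T. wt (x # xs) S0 S1)"
    by (subst sum.cartesian_product[symmetric]) (rule sum.swap)
  also have "\<dots> = (\<Sum>x\<in>\<Omega>. (\<Sum>xs\<in>?T. wt xs (insert x S0) S1) + (\<Sum>xs\<in>?T. wt xs S0 (insert x S1))
      + 1 / 8 * (\<Sum>xs\<in>?T. wt xs S0 S1))"
    by (simp only: wt.simps sum.distrib sum_distrib_left)
  also have "\<dots> \<le> (\<Sum>x\<in>\<Omega>. Z t (insert x S0) ^ a * Z t S1 ^ a * (?N / 2) ^ m
      + Z t S0 ^ a * Z t (insert x S1) ^ a * (?N / 2) ^ m + 1 / 8 * (Z t S0 ^ a * Z t S1 ^ a * (?N / 2) ^ m))"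
    by (intro sum_mono add_mono mult_left_mono Suc.IH) auto
  also have "\<dots> = (\<Sum>x\<in>\<Omega>. Z t (insert x S0) ^ a) * (Z t S1 ^ a * (?N / 2) ^ m)
      + (\<Sum>x\<in>\<Omega>. Z t (insert x S1) ^ a) * (Z t S0 ^ a * (?N / 2) ^ m)
      + ?N / 8 * (Z t S0 ^ a * Z t S1 ^ a * (?N / 2) ^ m)"
    by (simp add: sum.distrib sum_distrib_left sum_distrib_right mult_ac)
  also have "\<dots> \<le> 3 / 16 * ?N * Z t S0 ^ a * (Z t S1 ^ a * (?N / 2) ^ m)
      + 3 / 16 * ?N * Z t S1 ^ a * (Z t S0 ^ a * (?N / 2) ^ m)
      + ?N / 8 * (Z t S0 ^ a * Z t S1 ^ a * (?N / 2) ^ m)"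
    by (intro add_mono mult_right_mono step order.refl) (auto intro!: mult_nonneg_nonneg simp: Z0)
  also have "\<dots> = Z t S0 ^ a * Z t S1 ^ a * (?N / 2) ^ Suc m"
    by simp
  finally show ?case .
qed

section \<open>Random sequences of points and their collinear entries\<close>

definition seqs :: "nat \<Rightarrow> (nat \<Rightarrow> 'a) set" where
  "seqs m = {..<m} \<rightarrow>\<^sub>E \<Omega>"

lemma finite_seqs: "finite (seqs m)"
  unfolding seqs_def using finite_points by (intro finite_PiE) auto

lemma card_seqs: "card (seqs m) = card \<Omega> ^ m"
  unfolding seqs_def by (simp add: card_PiE)

text \<open>Colourings are counted recursively on lists, events at given indices on functions; this
  carries sums from one model to the other.\<close>

lemma sum_seqs_eq:
  "(\<Sum>f\<in>seqs m. F (map f [0..<m])) = (\<Sum>xs\<in>{xs. set xs \<subseteq> \<Omega> \<and> length xs = m}. F xs)"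
proof (rule sum.reindex_bij_betw)
  show "bij_betw (\<lambda>f. map f [0..<m]) (seqs m) {xs. set xs \<subseteq> \<Omega> \<and> length xs = m}"
    unfolding seqs_def
  proof (rule bij_betw_byWitness[where f' = "\<lambda>xs. restrict (\<lambda>i. xs ! i) {..<m}"])
    show "\<forall>f\<in>{..<m} \<rightarrow>\<^sub>E \<Omega>. restrict (\<lambda>i. map f [0..<m] ! i) {..<m} = f"
      by (auto simp: fun_eq_iff restrict_def PiE_def extensional_def)
    show "\<forall>xs\<in>{xs. set xs \<subseteq> \<Omega> \<and> length xs = m}. map (restrict (\<lambda>i. xs ! i) {..<m}) [0..<m] = xs"
      by (auto intro!: nth_equalityI)
    show "(\<lambda>f. map f [0..<m]) ` ({..<m} \<rightarrow>\<^sub>E \<Omega>) \<subseteq> {xs. set xs \<subseteq> \<Omega> \<and> length xs = m}"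
    proof (rule image_subsetI)
      fix f assume f: "f \<in> {..<m} \<rightarrow>\<^sub>E \<Omega>"
      have "set (map f [0..<m]) \<subseteq> \<Omega>" using PiE_mem[OF f] by auto
      then show "map f [0..<m] \<in> {xs. set xs \<subseteq> \<Omega> \<and> length xs = m}" by simp
    qed
    show "(\<lambda>xs. restrict (\<lambda>i. xs ! i) {..<m}) ` {xs. set xs \<subseteq> \<Omega> \<and> length xs = m} \<subseteq> {..<m} \<rightarrow>\<^sub>E \<Omega>"
    proof (rule image_subsetI)
      fix xs :: "'a list" assume xs: "xs \<in> {xs. set xs \<subseteq> \<Omega> \<and> length xs = m}"
      then have "xs ! i \<in> \<Omega>" if "i < m" for i using that nth_mem[of i xs] by blast
      then show "restrict (\<lambda>i. xs ! i) {..<m} \<in> {..<m} \<rightarrow>\<^sub>E \<Omega>" by simp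
    qed
  qed
qed

text \<open>Once the value at \<open>j\<close> is fixed, each index in \<open>K\<close> has
  \<open>n\<close> choices instead of \<open>card \<Omega>\<close>, and the remaining indices are
  free.\<close>

lemma card_seqs_collinear:
  assumes i: "i \<in> I" and j: "j < m" and K: "K \<subseteq> {..<m} - {j}"
  shows "real (card {f\<in>seqs m. \<forall>k\<in>K. f k \<in> line i (f j)}) = real (card \<Omega>) ^ m * (real n / real (card \<Omega>)) ^ card K"
proof -
  let ?N = "card \<Omega>"
  have N: "?N > 0" using points_nonempty finite_points by (simp add: card_gt_0_iff)
  define B where "B v k = (if k = j then {v} else if k \<in> K then line i v else \<Omega>)" for v k
  have set_eq: "{f\<in>seqs m. \<forall>k\<in>K. f k \<in> line i (f j)} = (\<Union>v\<in>\<Omega>. PiE {..<m} (B v))"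
  proof (intro equalityI subsetI)
    fix f assume "f \<in> {f\<in>seqs m. \<forall>k\<in>K. f k \<in> line i (f j)}"
    then have "f \<in> PiE {..<m} (B (f j))" "f j \<in> \<Omega>" using j K by (auto simp: seqs_def B_def PiE_iff)
    then show "f \<in> (\<Union>v\<in>\<Omega>. PiE {..<m} (B v))" by blast
  next
    fix f assume "f \<in> (\<Union>v\<in>\<Omega>. PiE {..<m} (B v))"
    then obtain v where v: "v \<in> \<Omega>" and f: "f \<in> PiE {..<m} (B v)" by blast
    have fj: "f j = v" using f j by (auto simp: PiE_iff B_def dest: bspec[of _ _ j])
    have fk: "f k \<in> line i v" if "k \<in> K" for k
    proof -
      have "k < m" "k \<noteq> j" using that K by auto
      then have "f k \<in> B v k" using f by auto
      then show ?thesis using that \<open>k \<noteq> j\<close> by (simp add: B_def)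
    qed
    have "f k \<in> \<Omega>" if "k < m" for k
    proof -
      have "f k \<in> B v k" using f that by auto
      then show ?thesis using v line_sub[OF i v] by (auto simp: B_def split: if_splits)
    qed
    then have "f \<in> seqs m" using f by (auto simp: seqs_def PiE_iff)
    then show "f \<in> {f\<in>seqs m. \<forall>k\<in>K. f k \<in> line i (f j)}" using fj fk by simp
  qed
  have card_B: "card (PiE {..<m} (B v)) * ?N * ?N ^ card K = ?N ^ m * n ^ card K" if v: "v \<in> \<Omega>" for v
  proof -
    have finK: "finite K" using K finite_subset by blast
    have "card (PiE {..<m} (B v)) = (\<Prod>k<m. card (B v k))" by (simp add: card_PiE)
    also have "\<dots> = (\<Prod>k\<in>{..<m} - {j}. card (B v k))"
      using j by (subst prod.remove[of _ j]) (auto simp: B_def)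
    also have "\<dots> = (\<Prod>k\<in>({..<m} - {j}) - K. card (B v k)) * (\<Prod>k\<in>K. card (B v k))"
      using K by (intro prod.subset_diff) auto
    also have "(\<Prod>k\<in>K. card (B v k)) = (\<Prod>k\<in>K. n)"
      using K line_card[OF i v] by (intro prod.cong) (auto simp: B_def)
    also have "(\<Prod>k\<in>({..<m} - {j}) - K. card (B v k)) = (\<Prod>k\<in>({..<m} - {j}) - K. ?N)"
      by (intro prod.cong) (auto simp: B_def)
    finally have *: "card (PiE {..<m} (B v)) = ?N ^ (m - 1 - card K) * n ^ card K"
      using K finK j by (simp add: card_Diff_subset)
    have "card K \<le> card ({..<m} - {j})" using K by (intro card_mono) auto
    then have "(m - 1 - card K) + 1 + card K = m" using j by simp
    then have "?N ^ (m - 1 - card K) * ?N * ?N ^ card K = ?N ^ m"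
      by (metis power_add power_one_right)
    then show ?thesis unfolding * by (metis mult.assoc mult.commute)
  qed
  have "card (\<Union>v\<in>\<Omega>. PiE {..<m} (B v)) = (\<Sum>v\<in>\<Omega>. card (PiE {..<m} (B v)))"
  proof (rule card_UN_disjoint[OF finite_points])
    show "\<forall>v\<in>\<Omega>. finite (PiE {..<m} (B v))"
      using finite_points finite_line[OF i] by (intro ballI finite_PiE) (auto simp: B_def)
    show "\<forall>v\<in>\<Omega>. \<forall>w\<in>\<Omega>. v \<noteq> w \<longrightarrow> PiE {..<m} (B v) \<inter> PiE {..<m} (B w) = {}"
    proof (intro ballI impI, rule ccontr)
      fix v w assume "v \<noteq> w" "PiE {..<m} (B v) \<inter> PiE {..<m} (B w) \<noteq> {}"
      then obtain f where "f \<in> PiE {..<m} (B v)" "f \<in> PiE {..<m} (B w)" by blast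
      then have "f j \<in> B v j" "f j \<in> B w j" using j by auto
      then show False using \<open>v \<noteq> w\<close> by (simp add: B_def)
    qed
  qed
  then have "real (card (\<Union>v\<in>\<Omega>. PiE {..<m} (B v))) = (\<Sum>v\<in>\<Omega>. real (card (PiE {..<m} (B v))))" by simp
  also have "\<dots> = (\<Sum>v\<in>\<Omega>. real ?N ^ m * (real n / real ?N) ^ card K / real ?N)"
  proof (rule sum.cong[OF refl])
    fix v assume "v \<in> \<Omega>"
    from card_B[OF this]
    have "real (card (PiE {..<m} (B v))) * real ?N * real ?N ^ card K = real ?N ^ m * real n ^ card K"
      by (metis of_nat_mult of_nat_power)
    then show "real (card (PiE {..<m} (B v))) = real ?N ^ m * (real n / real ?N) ^ card K / real ?N"
      using N by (simp add: field_simps power_divide)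
  qed
  also have "\<dots> = real ?N ^ m * (real n / real ?N) ^ card K" using N by simp
  finally show ?thesis unfolding set_eq .
qed

text \<open>Indices are counted rather than points, and \<open>j\<close> itself is left out. So
  \<open>k = r\<close> detects lines with more than \<open>r\<close> entries, and
  \<open>k = r - 1\<close> detects lines with at least \<open>r\<close>.\<close>

definition rich_dirs :: "nat \<Rightarrow> (nat \<Rightarrow> 'a) \<Rightarrow> nat \<Rightarrow> nat \<Rightarrow> 'i set" where
  "rich_dirs m f k j = {i\<in>I. k \<le> card {l\<in>{..<m} - {j}. f l \<in> line i (f j)}}"

text \<open>A union bound over the directions and the \<open>k\<close>-sets of further indices, of
  which there are at most \<open>m ^ k\<close>; each event is evaluated by
  \<open>card_seqs_collinear\<close>.\<close>

lemma sum_rich_dirs_le: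
  assumes j: "j < m"
  shows "(\<Sum>f\<in>seqs m. real (card (rich_dirs m f k j)))
     \<le> real (card \<Omega>) ^ m * (real (card I) * (real m * real n / real (card \<Omega>)) ^ k)"
proof -
  let ?K = "{K. K \<subseteq> {..<m} - {j} \<and> card K = k}" and ?N = "real (card \<Omega>)"
  have finK: "finite ?K" by simp
  have "(\<Sum>f\<in>seqs m. real (card (rich_dirs m f k j)))
      \<le> (\<Sum>f\<in>seqs m. \<Sum>i\<in>I. \<Sum>K\<in>?K. of_bool (\<forall>l\<in>K. f l \<in> line i (f j)))"
  proof (rule sum_mono)
    fix f
    have "real (card (rich_dirs m f k j)) = (\<Sum>i\<in>I. of_bool (k \<le> card {l\<in>{..<m} - {j}. f l \<in> line i (f j)}))"
      unfolding rich_dirs_def using finite_dirs by (simp add: Int_def)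
    also have "\<dots> \<le> (\<Sum>i\<in>I. \<Sum>K\<in>?K. of_bool (\<forall>l\<in>K. f l \<in> line i (f j)))"
    proof (rule sum_mono)
      fix i
      let ?A = "{l\<in>{..<m} - {j}. f l \<in> line i (f j)}"
      show "of_bool (k \<le> card ?A) \<le> (\<Sum>K\<in>?K. of_bool (\<forall>l\<in>K. f l \<in> line i (f j)) :: real)"
      proof (cases "k \<le> card ?A")
        case True
        then obtain K where K: "K \<subseteq> ?A" "card K = k" by (rule obtain_subset_with_card_n)
        then have "of_bool (\<forall>l\<in>K. f l \<in> line i (f j)) \<le> (\<Sum>K\<in>?K. of_bool (\<forall>l\<in>K. f l \<in> line i (f j)) :: real)"
          using finK by (intro member_le_sum) auto
        moreover have "of_bool (\<forall>l\<in>K. f l \<in> line i (f j)) = (1::real)" using K by auto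
        ultimately show ?thesis using True by simp
      next
        case False
        then show ?thesis by (simp add: sum_nonneg)
      qed
    qed
    finally show "real (card (rich_dirs m f k j)) \<le> (\<Sum>i\<in>I. \<Sum>K\<in>?K. of_bool (\<forall>l\<in>K. f l \<in> line i (f j)))" .
  qed
  also have "\<dots> = (\<Sum>i\<in>I. \<Sum>f\<in>seqs m. \<Sum>K\<in>?K. of_bool (\<forall>l\<in>K. f l \<in> line i (f j)))"
    by (rule sum.swap)
  also have "\<dots> = (\<Sum>i\<in>I. \<Sum>K\<in>?K. \<Sum>f\<in>seqs m. of_bool (\<forall>l\<in>K. f l \<in> line i (f j)))"
    by (intro sum.cong refl sum.swap)
  also have "\<dots> = (\<Sum>i\<in>I. \<Sum>K\<in>?K. ?N ^ m * (real n / ?N) ^ k)"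
  proof (intro sum.cong refl)
    fix i K assume i: "i \<in> I" and K: "K \<in> ?K"
    have "(\<Sum>f\<in>seqs m. of_bool (\<forall>l\<in>K. f l \<in> line i (f j))) = real (card {f\<in>seqs m. \<forall>l\<in>K. f l \<in> line i (f j)})"
      using finite_seqs by (simp add: Int_def)
    also have "\<dots> = ?N ^ m * (real n / ?N) ^ k" using card_seqs_collinear[OF i j] K by auto
    finally show "(\<Sum>f\<in>seqs m. of_bool (\<forall>l\<in>K. f l \<in> line i (f j))) = ?N ^ m * (real n / ?N) ^ k" .
  qed
  also have "\<dots> = real (card I) * (real (card ?K) * (?N ^ m * (real n / ?N) ^ k))" by simp
  also have "\<dots> \<le> real (card I) * (real m ^ k * (?N ^ m * (real n / ?N) ^ k))"
  proof -
    have "card ?K = (m - 1) choose k" using n_subsets[of "{..<m} - {j}" k] j by simp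
    also have "\<dots> \<le> m ^ k"
    proof (cases "k \<le> m - 1")
      case True
      then have "(m - 1) choose k \<le> (m - 1) ^ k" by (rule binomial_le_pow)
      also have "\<dots> \<le> m ^ k" by (intro power_mono) auto
      finally show ?thesis .
    qed (simp add: binomial_eq_0)
    finally have "real (card ?K) \<le> real m ^ k" by (metis of_nat_le_iff of_nat_power)
    then show ?thesis by (intro mult_left_mono mult_right_mono) auto
  qed
  also have "\<dots> = ?N ^ m * (real (card I) * (real m * real n / ?N) ^ k)"
    by (simp add: power_mult_distrib power_divide)
  finally show ?thesis .
qed

text \<open>First moment method with deletion. Some sequence has fewer than \<open>g\<close> bad
  indices and also \<open>wt\<close> below \<open>(1 / 8) ^ g\<close>. If the points left after
  deleting the bad entries split into independent sets, at most \<open>g\<close> entries would have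
  to be discarded, and \<open>wt_ge\<close> would contradict the second property.\<close>

theorem exists_uncolourable:
  fixes t :: real and c a g H m :: nat
  assumes t: "t > 0" "t \<le> 1 / (2 * (real r + 1)\<^sup>2)" and nc: "n = 16 * c" and c: "2 \<le> c" "r \<le> c"
    and rich: "\<And>k. k < r \<Longrightarrow> 32 * (real r + 1) * 2 ^ (r - 1) \<le> real (card I) * (real ((c - 1) choose k) * t ^ k)"
    and a: "a = 8 * (r + 1)\<^sup>2" and m: "m = 12 * g" and g: "g > 0" and H: "H > 0"
    and Zbound: "(1 + t) ^ (2 * a * card \<Omega>) \<le> 8 ^ g"
    and over: "48 * (real (card I) * (real m * real n / real (card \<Omega>)) ^ r) \<le> 1"
    and high: "48 * (real (card I) * (real m * real n / real (card \<Omega>)) ^ (r - 1)) \<le> real H"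
  shows "\<exists>V. V \<subseteq> \<Omega> \<and> (\<forall>i\<in>I. \<forall>v\<in>V. card (V \<inter> line i v) \<le> r) \<and>
      (\<forall>v\<in>V. card {i\<in>I. r \<le> card (V \<inter> line i v)} \<le> H) \<and>
      \<not> (\<exists>A B. V = A \<union> B \<and> indep A \<and> indep B)"
proof -
  let ?N = "real (card \<Omega>)"
  have N: "?N > 0" using points_nonempty finite_points by (simp add: card_gt_0_iff)
  \<comment> \<open>An index is bad if its point lies on a line with more than \<open>r\<close>
    entries, or on more than \<open>H\<close> lines with at least \<open>r\<close> entries.\<close>
  define bad where "bad f = {j. j < m \<and> (rich_dirs m f r j \<noteq> {} \<or> H < card (rich_dirs m f (r - 1) j))}" for f
  have finbad: "finite (bad f)" for f unfolding bad_def by simp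
  have finrd: "finite (rich_dirs m f k j)" for f k j unfolding rich_dirs_def using finite_dirs by simp
  have sum_bad: "(\<Sum>f\<in>seqs m. real (card (bad f))) \<le> real g / 2 * ?N ^ m"
  proof -
    have "(\<Sum>f\<in>seqs m. real (card (bad f)))
        \<le> (\<Sum>f\<in>seqs m. \<Sum>j<m. real (card (rich_dirs m f r j)) + real (card (rich_dirs m f (r - 1) j)) / real H)"
    proof (rule sum_mono)
      fix f
      have "real (card (bad f)) = (\<Sum>j<m. of_bool (rich_dirs m f r j \<noteq> {} \<or> H < card (rich_dirs m f (r - 1) j)))"
        unfolding bad_def by (simp add: Int_def)
      also have "\<dots> \<le> (\<Sum>j<m. real (card (rich_dirs m f r j)) + real (card (rich_dirs m f (r - 1) j)) / real H)"
      proof (rule sum_mono)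
        fix j
        consider "rich_dirs m f r j \<noteq> {}" | "rich_dirs m f r j = {}" "H < card (rich_dirs m f (r - 1) j)"
          | "rich_dirs m f r j = {}" "\<not> H < card (rich_dirs m f (r - 1) j)" by blast
        then show "of_bool (rich_dirs m f r j \<noteq> {} \<or> H < card (rich_dirs m f (r - 1) j))
            \<le> real (card (rich_dirs m f r j)) + real (card (rich_dirs m f (r - 1) j)) / real H"
        proof cases
          case 1
          then have "card (rich_dirs m f r j) \<ge> 1" using finrd by (simp add: Suc_le_eq card_gt_0_iff)
          then have "1 + 0 \<le> real (card (rich_dirs m f r j)) + real (card (rich_dirs m f (r - 1) j)) / real H"
            by (intro add_mono) auto
          then show ?thesis using 1 by simp
        next
          case 2
          then have "1 \<le> real (card (rich_dirs m f (r - 1) j)) / real H" using H by simp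
          then show ?thesis using 2 by simp
        next
          case 3
          then show ?thesis by simp
        qed
      qed
      finally show "real (card (bad f))
          \<le> (\<Sum>j<m. real (card (rich_dirs m f r j)) + real (card (rich_dirs m f (r - 1) j)) / real H)" .
    qed
    also have "\<dots> = (\<Sum>j<m. (\<Sum>f\<in>seqs m. real (card (rich_dirs m f r j)))
        + (\<Sum>f\<in>seqs m. real (card (rich_dirs m f (r - 1) j))) / real H)"
      by (subst sum.swap) (simp add: sum.distrib sum_divide_distrib)
    \<comment> \<open>Each of the \<open>12 * g\<close> indices fails either condition with
      probability at most 1/48, which gives \<open>g / 2\<close> bad indices on average.\<close>
    also have "\<dots> \<le> (\<Sum>j<m. ?N ^ m * (1 / 48) + ?N ^ m * (real H / 48) / real H)"
    proof (intro sum_mono add_mono divide_right_mono)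
      fix j assume "j \<in> {..<m}"
      then have j: "j < m" by simp
      show "(\<Sum>f\<in>seqs m. real (card (rich_dirs m f r j))) \<le> ?N ^ m * (1 / 48)"
        using over by (intro order.trans[OF sum_rich_dirs_le[OF j]] mult_left_mono) auto
      show "(\<Sum>f\<in>seqs m. real (card (rich_dirs m f (r - 1) j))) \<le> ?N ^ m * (real H / 48)"
        using high by (intro order.trans[OF sum_rich_dirs_le[OF j]] mult_left_mono) auto
    qed simp
    also have "\<dots> = real g / 2 * ?N ^ m" using H by (simp add: m)
    finally show ?thesis .
  qed
  have sum_wt: "(\<Sum>f\<in>seqs m. wt (map f [0..<m]) {} {}) \<le> 8 ^ g * (?N / 2) ^ m"
  proof -
    have "(\<Sum>f\<in>seqs m. wt (map f [0..<m]) {} {}) \<le> Z t {} ^ a * Z t {} ^ a * (?N / 2) ^ m"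
      unfolding sum_seqs_eq[where F="\<lambda>xs. wt xs {} {}"]
      by (rule sum_wt_le[OF t(1)]) (rule sum_Z_insert_le[OF t nc c rich a])
    also have "\<dots> \<le> 8 ^ g * (?N / 2) ^ m"
    proof (intro mult_right_mono)
      have "Z t {} ^ a * Z t {} ^ a = Z t {} ^ (2 * a)" by (simp add: power_add mult_2)
      also have "\<dots> \<le> ((1 + t) ^ card \<Omega>) ^ (2 * a)"
        using Z_empty_le[OF t(1)] Z_nonneg[OF t(1)] by (intro power_mono) auto
      also have "\<dots> = (1 + t) ^ (2 * a * card \<Omega>)" by (simp add: power_mult[symmetric] mult.commute)
      finally show "Z t {} ^ a * Z t {} ^ a \<le> 8 ^ g" using Zbound by linarith
    qed simp
    finally show ?thesis .
  qed
  \<comment> \<open>Averaging the sum of both quantities replaces two Markov estimates: the mean is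
    at most \<open>1 / 2 + (1 / 64) ^ g\<close>, where \<open>m = 12 * g\<close> makes
    \<open>2 ^ m\<close> outweigh \<open>64 ^ g\<close>.\<close>
  have "\<exists>f\<in>seqs m. real (card (bad f)) / real g + 8 ^ g * wt (map f [0..<m]) {} {} < 1"
  proof (rule ccontr)
    assume "\<not> ?thesis"
    then have "(\<Sum>f\<in>seqs m. 1) \<le> (\<Sum>f\<in>seqs m. real (card (bad f)) / real g + 8 ^ g * wt (map f [0..<m]) {} {})"
      by (intro sum_mono) force
    then have "?N ^ m \<le> (\<Sum>f\<in>seqs m. real (card (bad f))) / real g + 8 ^ g * (\<Sum>f\<in>seqs m. wt (map f [0..<m]) {} {})"
      by (simp add: card_seqs sum.distrib sum_divide_distrib sum_distrib_left)
    also have "\<dots> \<le> (real g / 2 * ?N ^ m) / real g + 8 ^ g * (8 ^ g * (?N / 2) ^ m)"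
      by (intro add_mono divide_right_mono mult_left_mono sum_bad sum_wt) auto
    also have "\<dots> = ?N ^ m * (1 / 2 + 64 ^ g * (1 / 2) ^ m)"
    proof -
      have "8 ^ g * (8 ^ g * (?N / 2) ^ m) = ?N ^ m * (64 ^ g * (1 / 2) ^ m)"
        by (simp add: power_divide flip: power_mult_distrib mult.assoc)
      then show ?thesis using g by (simp add: distrib_left)
    qed
    also have "64 ^ g * (1 / 2) ^ m = (1 / 64 :: real) ^ g"
    proof -
      have "64 ^ g * (1 / 2) ^ m = 64 ^ g * ((1 / 2 :: real) ^ 12) ^ g" unfolding m power_mult ..
      also have "\<dots> = (64 * (1 / 2 :: real) ^ 12) ^ g" by (rule power_mult_distrib[symmetric])
      finally show ?thesis by (simp add: power_divide)
    qed
    also have "?N ^ m * (1 / 2 + (1 / 64) ^ g) < ?N ^ m * 1"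
    proof (intro mult_strict_left_mono)
      have "(1 / 64 :: real) ^ g \<le> (1 / 64) ^ 1" using g by (intro power_decreasing) auto
      then show "1 / 2 + (1 / 64 :: real) ^ g < 1" by simp
    qed (use N in simp)
    finally show False by simp
  qed
  then obtain f where f: "f \<in> seqs m" and fsmall: "real (card (bad f)) / real g + 8 ^ g * wt (map f [0..<m]) {} {} < 1"
    by blast
  have few_bad: "card (bad f) < g"
  proof -
    have "8 ^ g * wt (map f [0..<m]) {} {} \<ge> 0" using wt_nonneg by simp
    then have "real (card (bad f)) / real g < 1" using fsmall by linarith
    then show ?thesis using g by simp
  qed
  have wt_small: "8 ^ g * wt (map f [0..<m]) {} {} < 1"
  proof -
    have "real (card (bad f)) / real g \<ge> 0" by simp
    then show ?thesis using fsmall by linarith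
  qed
  define V where "V = f ` ({..<m} - bad f)"
  have f\<Omega>: "f j \<in> \<Omega>" if "j < m" for j using f that unfolding seqs_def by auto
  have V\<Omega>: "V \<subseteq> \<Omega>" unfolding V_def using f\<Omega> by auto
  \<comment> \<open>The successor accounts for \<open>f j\<close> itself; repeated entries only
    lower the number of points.\<close>
  have card_class: "card (V \<inter> line i (f j)) \<le> Suc (card {l\<in>{..<m} - {j}. f l \<in> line i (f j)})" for i j
  proof -
    let ?A = "{l\<in>{..<m} - {j}. f l \<in> line i (f j)}"
    have "V \<inter> line i (f j) \<subseteq> insert (f j) (f ` ?A)" unfolding V_def by auto
    then have "card (V \<inter> line i (f j)) \<le> card (insert (f j) (f ` ?A))" by (intro card_mono) auto
    also have "\<dots> \<le> Suc (card (f ` ?A))" by (simp add: card_insert_if)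
    also have "\<dots> \<le> Suc (card ?A)" using card_image_le[of ?A f] by simp
    finally show ?thesis .
  qed
  have "card (V \<inter> line i v) \<le> r" if i: "i \<in> I" and v: "v \<in> V" for i v
  proof -
    obtain j where j: "j < m" "j \<notin> bad f" "v = f j" using v unfolding V_def by auto
    then have "i \<notin> rich_dirs m f r j" unfolding bad_def by auto
    then have "card {l\<in>{..<m} - {j}. f l \<in> line i (f j)} < r" using i unfolding rich_dirs_def by auto
    then show ?thesis using card_class[of i j] j by simp
  qed
  moreover have "card {i\<in>I. r \<le> card (V \<inter> line i v)} \<le> H" if v: "v \<in> V" for v
  proof -
    obtain j where j: "j < m" "j \<notin> bad f" "v = f j" using v unfolding V_def by auto
    have "{i\<in>I. r \<le> card (V \<inter> line i v)} \<subseteq> rich_dirs m f (r - 1) j"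
    proof
      fix i assume "i \<in> {i\<in>I. r \<le> card (V \<inter> line i v)}"
      then have "i \<in> I" "r \<le> card (V \<inter> line i (f j))" using j by auto
      then show "i \<in> rich_dirs m f (r - 1) j" using card_class[of i j] unfolding rich_dirs_def by simp
    qed
    then have "card {i\<in>I. r \<le> card (V \<inter> line i v)} \<le> card (rich_dirs m f (r - 1) j)"
      using finrd by (intro card_mono) auto
    also have "\<dots> \<le> H" using j unfolding bad_def by auto
    finally show ?thesis .
  qed
  moreover have False if AB: "V = A \<union> B" "indep A" "indep B" for A B
  proof -
    let ?xs = "map f [0..<m]"
    have "length (filter (\<lambda>x. x \<notin> A \<union> B) ?xs) = card {j. j < m \<and> f j \<notin> A \<union> B}"
      by (simp add: filter_map o_def length_filter_conv_card del: Un_iff cong: conj_cong)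
    \<comment> \<open>An entry with a good index lies in \<open>V\<close>, hence in
      \<open>A \<union> B\<close>, so every discarded index is bad.\<close>
    also have "\<dots> \<le> card (bad f)"
      using AB(1) finbad unfolding V_def by (intro card_mono) auto
    finally have "length (filter (\<lambda>x. x \<notin> A \<union> B) ?xs) \<le> g" using few_bad by simp
    then have "(1 / 8 :: real) ^ g \<le> (1 / 8) ^ length (filter (\<lambda>x. x \<notin> A \<union> B) ?xs)"
      by (intro power_decreasing) auto
    also have "\<dots> \<le> wt ?xs {} {}" using AB by (intro wt_ge) auto
    finally have "8 ^ g * (1 / 8 :: real) ^ g \<le> 8 ^ g * wt ?xs {} {}" by (intro mult_left_mono) auto
    moreover have "8 ^ g * (1 / 8 :: real) ^ g = 1" by (simp add: power_divide)
    ultimately show False using wt_small by linarith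
  qed
  ultimately show ?thesis using V\<Omega> by (intro exI[of _ V]) blast
qed

end

section \<open>Axis-parallel lines in a cube and their planar dual\<close>

definition cube :: "nat \<Rightarrow> nat \<Rightarrow> (nat \<Rightarrow> nat) set" where
  "cube D n = {..<D} \<rightarrow>\<^sub>E {..<n}"

definition axis :: "nat \<Rightarrow> nat \<Rightarrow> nat \<Rightarrow> (nat \<Rightarrow> nat) \<Rightarrow> (nat \<Rightarrow> nat) set" where
  "axis D n i v = {w\<in>cube D n. \<forall>j. j \<noteq> i \<longrightarrow> w j = v j}"

lemma cube_net:
  assumes "0 < n" "0 < r"
  shows "net (cube D n) {..<D} (axis D n) n r"
proof
  show "finite (cube D n)" unfolding cube_def by (intro finite_PiE) auto
  show "cube D n \<noteq> {}" unfolding cube_def using assms by (simp add: PiE_eq_empty_iff lessThan_empty_iff)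
  show "card (axis D n i v) = n" if "i \<in> {..<D}" "v \<in> cube D n" for i v
  proof -
    have "axis D n i v = (\<lambda>x. v(i := x)) ` {..<n}"
    proof (intro equalityI subsetI)
      fix w assume w: "w \<in> axis D n i v"
      then have "w = v(i := w i)" "w i < n" using that by (auto simp: axis_def cube_def fun_eq_iff)
      then show "w \<in> (\<lambda>x. v(i := x)) ` {..<n}" by blast
    next
      fix w assume "w \<in> (\<lambda>x. v(i := x)) ` {..<n}"
      then show "w \<in> axis D n i v"
        using that by (auto simp: axis_def cube_def PiE_iff extensional_def)
    qed
    moreover have "inj_on (\<lambda>x. v(i := x)) {..<n}" by (auto simp: inj_on_def dest: fun_upd_eqD)
    ultimately show ?thesis by (simp add: card_image)
  qed
  show "axis D n i v \<inter> axis D n j v = {v}" if "i \<noteq> j" "v \<in> cube D n" for i j v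
  proof -
    have "w = v" if "w \<in> axis D n i v" "w \<in> axis D n j v" for w
    proof
      fix l show "w l = v l" using that \<open>i \<noteq> j\<close> by (cases "l = i") (auto simp: axis_def)
    qed
    then show ?thesis using that by (auto simp: axis_def)
  qed
qed (use assms in \<open>auto simp: axis_def\<close>)

text \<open>Uniqueness of expansions with signed digits: \<open>M\<close> divides the constant
  digit, which is smaller than \<open>M\<close> in absolute value and so vanishes; division by
  \<open>M\<close> leaves a shorter expansion.\<close>

lemma digits_eq_0:
  fixes M :: int
  assumes "\<And>j. j < D \<Longrightarrow> \<bar>c j\<bar> < M" "(\<Sum>j<D. c j * M ^ j) = 0" "j < D"
  shows "c j = 0"
  using assms
proof (induction D arbitrary: c j)
  case (Suc D)
  have s: "(\<Sum>j<Suc D. c j * M ^ j) = c 0 + M * (\<Sum>j<D. c (Suc j) * M ^ j)"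
    unfolding sum.lessThan_Suc_shift by (simp add: sum_distrib_left mult_ac)
  then have "M dvd c 0" using Suc.prems(2) by (metis dvd_add_left_iff dvd_0_right dvd_triv_left)
  then have c0: "c 0 = 0" using Suc.prems(1)[of 0] zdvd_imp_le[of M "\<bar>c 0\<bar>"] by force
  have "M > 0" using Suc.prems(1)[of 0] by simp
  then have "(\<Sum>j<D. c (Suc j) * M ^ j) = 0" using s c0 Suc.prems(2) by simp
  then have "c (Suc i) = 0" if "i < D" for i using Suc.IH[of "\<lambda>j. c (Suc j)" i] Suc.prems(1) that by simp
  then show ?case using c0 Suc.prems(3) by (cases j) auto
qed simp

text \<open>At \<open>x = i\<close> the height does not depend on the coordinate \<open>i\<close>, so all lines of a class of
  direction \<open>i\<close> are concurrent there; the large base separates distinct classes.\<close>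

definition height :: "nat \<Rightarrow> nat \<Rightarrow> (nat \<Rightarrow> nat) \<Rightarrow> real \<Rightarrow> real" where
  "height D n v x = (\<Sum>j<D. real (v j) * real (n * D + 1) ^ j * (x - real j))"

text \<open>The difference of the heights is an expansion in base \<open>n * D + 1\<close> with
  digits \<open>(v j - w j) * (i - j)\<close>, all smaller than the base in absolute value. Digit
  \<open>i\<close> is always zero, and any other digit vanishes only if
  \<open>v j = w j\<close>.\<close>

lemma height_eq_iff:
  assumes v: "v \<in> cube D n" and w: "w \<in> cube D n" and i: "i < D"
  shows "height D n v (real i) = height D n w (real i) \<longleftrightarrow> v \<in> axis D n i w"
proof
  assume "v \<in> axis D n i w"
  then show "height D n v (real i) = height D n w (real i)"
    unfolding height_def axis_def by (intro sum.cong refl) auto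
next
  assume eq: "height D n v (real i) = height D n w (real i)"
  define M where "M = int (n * D + 1)"
  define c where "c j = (int (v j) - int (w j)) * (int i - int j)" for j
  have "of_int (\<Sum>j<D. c j * M ^ j) = height D n v (real i) - height D n w (real i)"
    unfolding height_def c_def M_def sum_subtractf[symmetric] of_int_sum
    by (intro sum.cong refl) (simp add: algebra_simps)
  then have "(of_int (\<Sum>j<D. c j * M ^ j) :: real) = 0" using eq by (simp only: diff_self)
  then have s: "(\<Sum>j<D. c j * M ^ j) = 0" by (simp only: of_int_eq_0_iff)
  have bound: "\<bar>c j\<bar> < M" if j: "j < D" for j
  proof -
    have "v j < n" "w j < n" using v w j unfolding cube_def by auto
    then have "\<bar>int (v j) - int (w j)\<bar> \<le> int n" by linarith
    moreover have "\<bar>int i - int j\<bar> \<le> int D" using i j by linarith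
    ultimately have "\<bar>c j\<bar> \<le> int n * int D" unfolding c_def abs_mult by (intro mult_mono) auto
    then show ?thesis unfolding M_def by simp
  qed
  have "v j = w j" if "j \<noteq> i" for j
  proof (cases "j < D")
    case True
    then have "c j = 0" using digits_eq_0[OF bound s] by simp
    then show ?thesis using that unfolding c_def by simp
  next
    \<comment> \<open>Beyond \<open>D\<close> both functions take the same default value, by
      extensionality.\<close>
    case False
    then show ?thesis using v w unfolding cube_def by (auto simp: PiE_iff extensional_def)
  qed
  then show "v \<in> axis D n i w" using v unfolding axis_def by simp
qed

definition graph_line :: "nat \<Rightarrow> nat \<Rightarrow> (nat \<Rightarrow> nat) \<Rightarrow> (real \<times> real) set" where
  "graph_line D n v = {(x, y). y = height D n v x}"

lemma is_line_graph_line: "is_line (graph_line D n v)"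
proof -
  define s where "s = (\<Sum>j<D. real (v j) * real (n * D + 1) ^ j)"
  define q where "q = (\<Sum>j<D. real (v j) * real (n * D + 1) ^ j * real j)"
  have "height D n v x = s * x - q" for x
    unfolding height_def s_def q_def by (simp add: right_diff_distrib sum_subtractf sum_distrib_right)
  then have "graph_line D n v = {(x, y). (- s) * x + 1 * y = - q}"
    unfolding graph_line_def by auto
  then show ?thesis unfolding is_line_def by (metis zero_neq_one)
qed

text \<open>Equal lines have equal heights at 0 and at 1. Since \<open>2 \<le> D\<close>, both are
  directions, so the two points agree off coordinate 0 and off coordinate 1, hence
  everywhere.\<close>

lemma inj_on_graph_line:
  assumes "2 \<le> D"
  shows "inj_on (graph_line D n) (cube D n)"
proof (rule inj_onI)
  fix v w assume vw: "v \<in> cube D n" "w \<in> cube D n" and eq: "graph_line D n v = graph_line D n w"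
  have "(x, height D n v x) \<in> graph_line D n w" for x
    using eq[symmetric] by (simp add: graph_line_def)
  then have "height D n v x = height D n w x" for x by (simp add: graph_line_def)
  then have "v \<in> axis D n 0 w" "v \<in> axis D n 1 w"
    using height_eq_iff[OF vw] assms by (metis Suc_1 Suc_le_lessD less_trans zero_less_one One_nat_def)+
  then have "v l = w l" for l by (cases "l = 0") (simp_all add: axis_def)
  then show "v = w" by (rule ext)
qed

text \<open>Points of \<open>V\<close> become lines, and axis lines with \<open>r\<close> points of
  \<open>V\<close> become points. As no axis line has more than \<open>r\<close> points of
  \<open>V\<close>, a class violating independence contains all of them on some axis line, and the
  other class misses the dual point.\<close>

lemma realise_in_plane:
  assumes D: "2 \<le> D" and n: "0 < n" and r: "0 < r" and V: "V \<subseteq> cube D n"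
    and le_r: "\<forall>i\<in>{..<D}. \<forall>v\<in>V. card (V \<inter> axis D n i v) \<le> r"
    and few: "\<forall>v\<in>V. card {i\<in>{..<D}. r \<le> card (V \<inter> axis D n i v)} \<le> H"
    and uncol: "\<not> (\<exists>A B. V = A \<union> B \<and> net.indep (cube D n) {..<D} (axis D n) r A
                      \<and> net.indep (cube D n) {..<D} (axis D n) r B)"
    and T: "H * (r - 1) \<le> T"
  shows "\<exists>(P :: (real \<times> real) set) (L :: (real \<times> real) set set).
    finite P \<and> finite L \<and> (\<forall>l\<in>L. is_line l) \<and>
    (\<forall>p\<in>P. card {l\<in>L. p \<in> l} \<ge> r) \<and>
    (\<forall>l\<in>L. card {l'\<in>L. l' \<noteq> l \<and> l \<inter> l' \<inter> P \<noteq> {}} \<le> T) \<and>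
    \<not> (\<exists>L1 L2. L1 \<union> L2 = L \<and> L1 \<inter> L2 = {} \<and>
          (\<forall>p\<in>P. (\<exists>l\<in>L1. p \<in> l) \<and> (\<exists>l\<in>L2. p \<in> l)))"
proof -
  interpret net "cube D n" "{..<D}" "axis D n" n r by (rule cube_net[OF n r])
  let ?l = "graph_line D n" and ?ax = "axis D n" and ?h = "height D n"
  define rich where "rich i v \<longleftrightarrow> r \<le> card (V \<inter> ?ax i v)" for i v
  define L where "L = ?l ` V"
  define P where "P = {(real i, ?h w (real i)) | i w. i < D \<and> w \<in> V \<and> rich i w}"
  have finV: "finite V" using V finite_points finite_subset by blast
  have inj: "inj_on ?l V" using inj_on_graph_line[OF D] V inj_on_subset by blast
  have mem: "(real i, ?h w (real i)) \<in> ?l v \<longleftrightarrow> v \<in> ?ax i w" if "i < D" "v \<in> V" "w \<in> V" for i v w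
    using height_eq_iff[OF subsetD[OF V that(2)] subsetD[OF V that(3)] that(1)] by (auto simp: graph_line_def)
  have ax_eq: "?ax i u = ?ax i w" if "i < D" "w \<in> V" "u \<in> ?ax i w" for i u w
    using line_eq[of i w u] that subsetD[OF V] by simp
  have "finite P"
  proof (rule finite_subset)
    show "P \<subseteq> (\<lambda>(i, w). (real i, ?h w (real i))) ` ({..<D} \<times> V)" unfolding P_def by auto
  qed (use finV in simp)
  moreover have "finite L" unfolding L_def using finV by simp
  moreover have "\<forall>l\<in>L. is_line l" unfolding L_def using is_line_graph_line by blast
  moreover have "\<forall>p\<in>P. card {l\<in>L. p \<in> l} \<ge> r"
  proof
    fix p assume "p \<in> P"
    then obtain i w where p: "p = (real i, ?h w (real i))" "i < D" "w \<in> V" "rich i w" unfolding P_def by blast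
    have "{l\<in>L. p \<in> l} = ?l ` (V \<inter> ?ax i w)" unfolding L_def using mem p by auto
    moreover have "inj_on ?l (V \<inter> ?ax i w)" using inj inj_on_subset by blast
    ultimately show "card {l\<in>L. p \<in> l} \<ge> r" using p(4) unfolding rich_def by (simp add: card_image)
  qed
  moreover have "\<forall>l\<in>L. card {l'\<in>L. l' \<noteq> l \<and> l \<inter> l' \<inter> P \<noteq> {}} \<le> T"
  proof
    fix l assume "l \<in> L"
    then obtain v where v: "v \<in> V" "l = ?l v" unfolding L_def by blast
    let ?I = "{i\<in>{..<D}. r \<le> card (V \<inter> ?ax i v)}"
    have vc: "v \<in> cube D n" using v V by blast
    \<comment> \<open>A line meeting \<open>l\<close> in a point of \<open>P\<close> is dual to a
      point on one of the at most \<open>H\<close> rich axis lines through \<open>v\<close>, each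
      with at most \<open>r - 1\<close> further points of \<open>V\<close>.\<close>
    have "{l'\<in>L. l' \<noteq> l \<and> l \<inter> l' \<inter> P \<noteq> {}} \<subseteq> ?l ` (\<Union>i\<in>?I. (V \<inter> ?ax i v) - {v})"
    proof
      fix l' assume "l' \<in> {l'\<in>L. l' \<noteq> l \<and> l \<inter> l' \<inter> P \<noteq> {}}"
      then obtain v' i w where v': "v' \<in> V" "l' = ?l v'" "l' \<noteq> l"
        and iw: "i < D" "w \<in> V" "rich i w" "(real i, ?h w (real i)) \<in> l" "(real i, ?h w (real i)) \<in> l'"
        unfolding L_def P_def by blast
      have "v \<in> ?ax i w" "v' \<in> ?ax i w" using iw mem v v' by auto
      then have "?ax i v = ?ax i w" using ax_eq iw by blast
      then have "i \<in> ?I" "v' \<in> (V \<inter> ?ax i v) - {v}"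
        using iw v v' \<open>v' \<in> ?ax i w\<close> unfolding rich_def by auto
      then show "l' \<in> ?l ` (\<Union>i\<in>?I. (V \<inter> ?ax i v) - {v})" using v' by blast
    qed
    then have "card {l'\<in>L. l' \<noteq> l \<and> l \<inter> l' \<inter> P \<noteq> {}} \<le> card (\<Union>i\<in>?I. (V \<inter> ?ax i v) - {v})"
      by (rule surj_card_le[rotated]) (use finV in simp)
    also have "\<dots> \<le> (\<Sum>i\<in>?I. card ((V \<inter> ?ax i v) - {v}))" by (rule card_UN_le) simp
    also have "\<dots> \<le> (\<Sum>i\<in>?I. r - 1)"
    proof (rule sum_mono)
      fix i assume i: "i \<in> ?I"
      then have "v \<in> V \<inter> ?ax i v" using v vc line_self by simp
      then have "card ((V \<inter> ?ax i v) - {v}) = card (V \<inter> ?ax i v) - 1" by (simp add: card_Diff_singleton)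
      moreover have "card (V \<inter> ?ax i v) \<le> r" using le_r i v by simp
      ultimately show "card ((V \<inter> ?ax i v) - {v}) \<le> r - 1" by simp
    qed
    also have "\<dots> = card ?I * (r - 1)" by simp
    also have "\<dots> \<le> H * (r - 1)" using few v by (intro mult_right_mono) auto
    finally show "card {l'\<in>L. l' \<noteq> l \<and> l \<inter> l' \<inter> P \<noteq> {}} \<le> T" using T by linarith
  qed
  moreover have "\<not> (\<exists>L1 L2. L1 \<union> L2 = L \<and> L1 \<inter> L2 = {} \<and>
          (\<forall>p\<in>P. (\<exists>l\<in>L1. p \<in> l) \<and> (\<exists>l\<in>L2. p \<in> l)))"
  proof
    assume "\<exists>L1 L2. L1 \<union> L2 = L \<and> L1 \<inter> L2 = {} \<and> (\<forall>p\<in>P. (\<exists>l\<in>L1. p \<in> l) \<and> (\<exists>l\<in>L2. p \<in> l))"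
    then obtain L1 L2 where L12: "L1 \<union> L2 = L" "L1 \<inter> L2 = {}"
      "\<And>p. p \<in> P \<Longrightarrow> \<exists>l\<in>L1. p \<in> l" "\<And>p. p \<in> P \<Longrightarrow> \<exists>l\<in>L2. p \<in> l" by blast
    have "indep {v\<in>V. ?l v \<in> K}" if K: "K \<inter> K' = {}" "K' \<subseteq> L" "\<And>p. p \<in> P \<Longrightarrow> \<exists>l\<in>K'. p \<in> l" for K K'
      unfolding indep_def
    proof (intro ballI, rule ccontr)
      fix i v assume i: "i \<in> {..<D}" and v: "v \<in> cube D n"
        and "\<not> card ({v\<in>V. ?l v \<in> K} \<inter> ?ax i v) < r"
      then have big: "r \<le> card ({v\<in>V. ?l v \<in> K} \<inter> ?ax i v)" by simp
      then have "{v\<in>V. ?l v \<in> K} \<inter> ?ax i v \<noteq> {}" using r by (metis card.empty leD)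
      then obtain w where w: "w \<in> V" "?l w \<in> K" "w \<in> ?ax i v" by blast
      then have e: "?ax i w = ?ax i v" using line_eq i v by blast
      have sub: "{v\<in>V. ?l v \<in> K} \<inter> ?ax i v \<subseteq> V \<inter> ?ax i w" using e by blast
      have "card (V \<inter> ?ax i w) \<le> r" using le_r i w by blast
      \<comment> \<open>At most \<open>r\<close> points of \<open>V\<close> lie on this axis line,
        so the \<open>r\<close> points with lines in \<open>K\<close> are all of them, and no line
        is left for \<open>K'\<close> at the dual point.\<close>
      then have all: "{v\<in>V. ?l v \<in> K} \<inter> ?ax i v = V \<inter> ?ax i w"
        using finV big sub by (intro card_seteq) auto
      have "rich i w" unfolding rich_def using big all by simp
      then have "(real i, ?h w (real i)) \<in> P" unfolding P_def using i w by blast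
      then obtain l where l: "l \<in> K'" "(real i, ?h w (real i)) \<in> l" using K(3) by blast
      then obtain u where u: "u \<in> V" "l = ?l u" using K(2) unfolding L_def by blast
      then have "u \<in> ?ax i w" using mem[of i u w] l i w by simp
      then have "?l u \<in> K" using all u by blast
      then show False using K(1) l u by blast
    qed
    from this[of L1 L2] this[of L2 L1] have "indep {v\<in>V. ?l v \<in> L1}" "indep {v\<in>V. ?l v \<in> L2}"
      using L12 by blast+
    moreover have "V = {v\<in>V. ?l v \<in> L1} \<union> {v\<in>V. ?l v \<in> L2}" using L12(1) unfolding L_def by blast
    ultimately show False using uncol by blast
  qed
  ultimately show ?thesis by blast
qed

section \<open>Choice of parameters\<close>

text \<open>The left side is \<open>H * (r - 1)\<close> for the parameters chosen below. For
  \<open>3 \<le> r\<close> the constants are absorbed into powers of \<open>r\<close>, and the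
  resulting exponent \<open>12 * r - 2\<close> is below \<open>5 * r\<^sup>2\<close>.\<close>

lemma degree_bound:
  fixes r :: nat
  assumes r: "3 \<le> r"
  shows "1536 * (r + 1) * (4 * r * (2304 * (r + 1)\<^sup>2)) ^ (r - 1) * (r - 1) \<le> r ^ (5 * r\<^sup>2)"
proof -
  have pow: "3 ^ k \<le> r ^ k" for k using r by (intro power_mono) auto
  have "9 * (r + 1)\<^sup>2 \<le> 16 * r\<^sup>2"
  proof -
    have "3 * (r + 1) \<le> 4 * r" using r by simp
    then have "(3 * (r + 1))\<^sup>2 \<le> (4 * r)\<^sup>2" by (rule power_mono) simp
    then show ?thesis by (simp only: power_mult_distrib) simp
  qed
  then have "2304 * (r + 1)\<^sup>2 \<le> 4096 * r\<^sup>2" by linarith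
  then have "4 * r * (2304 * (r + 1)\<^sup>2) \<le> 4 * r * (4096 * r\<^sup>2)" by (rule mult_le_mono2)
  also have "\<dots> = 16384 * r ^ 3" by (simp add: power2_eq_square power3_eq_cube)
  also have "\<dots> \<le> 3 ^ 9 * r ^ 3" by simp
  also have "\<dots> \<le> r ^ 9 * r ^ 3" by (intro mult_right_mono pow) auto
  also have "\<dots> = r ^ 12" by (simp flip: power_add)
  finally have 1: "4 * r * (2304 * (r + 1)\<^sup>2) \<le> r ^ 12" .
  have "1536 \<le> (3::nat) ^ 7" by simp
  then have 2: "1536 \<le> r ^ 7" using pow[of 7] by linarith
  have "r + 1 \<le> 3 * r" using r by simp
  also have "\<dots> \<le> r ^ 2" using r by (simp add: power2_eq_square)
  finally have 3: "r + 1 \<le> r ^ 2" .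
  have "1536 * (r + 1) * (4 * r * (2304 * (r + 1)\<^sup>2)) ^ (r - 1) * (r - 1)
      \<le> r ^ 7 * r ^ 2 * (r ^ 12) ^ (r - 1) * r ^ 1"
    using 1 2 3 by (intro mult_le_mono power_mono) auto
  also have "\<dots> = r ^ (7 + 2 + 12 * (r - 1) + 1)" by (simp only: power_add power_mult)
  also have "\<dots> \<le> r ^ (5 * r\<^sup>2)"
  proof (rule power_increasing)
    have "3 * r \<le> r\<^sup>2" using r by (simp add: power2_eq_square)
    then show "7 + 2 + 12 * (r - 1) + 1 \<le> 5 * r\<^sup>2" using r by linarith
  qed (use r in simp)
  finally show ?thesis .
qed

text \<open>For positive \<open>k\<close>, the estimate \<open>((U - 1) / k) ^ k\<close> for the
  binomial is combined with \<open>k \<le> r\<close> and \<open>U \<le> 2 * (U - 1)\<close>.\<close>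

lemma binomial_lower:
  fixes r U k :: nat
  assumes "k < r" "2 * r \<le> U"
  shows "(real U / (2 * real r)) ^ k \<le> real ((U - 1) choose k)"
proof (cases "k = 0")
  case False
  have "real U / (2 * real r) \<le> real (U - 1) / real k"
  proof -
    have "real U * real k \<le> real U * real r" using assms by (intro mult_left_mono) auto
    also have "\<dots> \<le> (2 * real (U - 1)) * real r" using assms by (intro mult_right_mono) auto
    finally show ?thesis using assms False by (simp add: field_simps)
  qed
  then have "(real U / (2 * real r)) ^ k \<le> (real (U - 1) / real k) ^ k" by (intro power_mono) auto
  also have "\<dots> \<le> real ((U - 1) choose k)" using assms by (intro binomial_ge_n_over_k_pow_k) auto
  finally show ?thesis .
qed simp

lemma exists_uncolourable_cube:
  fixes r :: nat
  assumes r: "0 < r"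
  shows "\<exists>D n V. 2 \<le> D \<and> 0 < n \<and> V \<subseteq> cube D n \<and>
      (\<forall>i\<in>{..<D}. \<forall>v\<in>V. card (V \<inter> axis D n i v) \<le> r) \<and>
      (\<forall>v\<in>V. card {i\<in>{..<D}. r \<le> card (V \<inter> axis D n i v)}
         \<le> 1536 * (r + 1) * (4 * r * (2304 * (r + 1)\<^sup>2)) ^ (r - 1)) \<and>
      \<not> (\<exists>A B. V = A \<union> B \<and> net.indep (cube D n) {..<D} (axis D n) r A
                      \<and> net.indep (cube D n) {..<D} (axis D n) r B)"
proof -
  \<comment> \<open>With \<open>m = 12 * g\<close>, a fixed line receives
    \<open>m * n / n ^ D = Q / U\<close> entries on average, since
    \<open>12 * 3072 / 16 = 2304\<close>.\<close>
  define Q where "Q = 2304 * (r + 1)\<^sup>2"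
  \<comment> \<open>Makes \<open>48 * D * (Q / U) ^ r\<close> equal to 1, so that overfull lines are
    rare.\<close>
  define U where "U = 1536 * (r + 1) * (4 * r) ^ (r - 1) * Q ^ r"
  define n where "n = 16 * U"
  \<comment> \<open>Richness dictates this size: \<open>((U - 1) choose k) * t ^ k\<close> is at
    least \<open>1 / (2 * r * U) ^ k\<close>, which \<open>D\<close> compensates together with the
    factor \<open>2 ^ (r - 1)\<close>.\<close>
  define D where "D = 32 * (r + 1) * (4 * r * U) ^ (r - 1)"
  define t where "t = 1 / (real U)\<^sup>2"
  define a where "a = 8 * (r + 1)\<^sup>2"
  \<comment> \<open>As \<open>t * n\<^sup>2 = 256\<close>, the exponent
    \<open>2 * a * n ^ D * t\<close> is 4096 times \<open>(r + 1)\<^sup>2 * n ^ (D - 2)\<close>. The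
    constant 3072 suffices because \<open>exp 1 \<le> 4\<close> and
    \<open>4 ^ 4096 \<le> 8 ^ 3072\<close>.\<close>
  define g where "g = 3072 * (r + 1)\<^sup>2 * n ^ (D - 2)"
  \<comment> \<open>This is \<open>48 * D * (Q / U) ^ (r - 1)\<close>; the powers of
    \<open>U\<close> cancel.\<close>
  define H where "H = 1536 * (r + 1) * (4 * r * Q) ^ (r - 1)"
  have Q: "Q > 0" unfolding Q_def by simp
  have U_ge: "1536 * (r + 1) \<le> U"
  proof -
    have "1536 * (r + 1) * 1 * 1 \<le> U" unfolding U_def using r Q by (intro mult_le_mono one_le_power) auto
    then show ?thesis by simp
  qed
  then have U: "U > 0" "2 * r \<le> U" by auto
  have n: "n > 0" unfolding n_def using U by simp
  have D: "D \<ge> 2"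
  proof -
    have "32 * (r + 1) * 1 \<le> D" unfolding D_def using r U by (intro mult_le_mono one_le_power) auto
    then show ?thesis by simp
  qed
  interpret net "cube D n" "{..<D}" "axis D n" n r by (rule cube_net[OF n r])
  have cube_card: "card (cube D n) = n ^ D" unfolding cube_def by (simp add: card_PiE)
  have nD: "real n ^ D = real n ^ (D - 2) * (real n)\<^sup>2" using D by (metis le_add_diff_inverse2 power_add)
  have lam: "real (12 * g) * real n / real (card (cube D n)) = real Q / real U"
  proof -
    have "real (12 * g) * real n = 16 * real Q * real n ^ (D - 2) * real n" unfolding g_def Q_def by simp
    also have "\<dots> / real (n ^ D) = 16 * real Q / real n"
      using n by (simp add: nD power2_eq_square)
    also have "\<dots> = real Q / real U" using U by (simp add: n_def)
    finally show ?thesis using cube_card by simp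
  qed
  have "\<exists>V. V \<subseteq> cube D n \<and> (\<forall>i\<in>{..<D}. \<forall>v\<in>V. card (V \<inter> axis D n i v) \<le> r) \<and>
      (\<forall>v\<in>V. card {i\<in>{..<D}. r \<le> card (V \<inter> axis D n i v)} \<le> H) \<and>
      \<not> (\<exists>A B. V = A \<union> B \<and> indep A \<and> indep B)"
  proof (rule exists_uncolourable)
    show "t > 0" unfolding t_def using U by simp
    show "t \<le> 1 / (2 * (real r + 1)\<^sup>2)"
    proof -
      have "2 * x\<^sup>2 \<le> (1536 * x)\<^sup>2" for x :: real by (simp add: power_mult_distrib)
      then have "2 * (real r + 1)\<^sup>2 \<le> (1536 * (real r + 1))\<^sup>2" .
      also have "\<dots> \<le> (real U)\<^sup>2"
      proof (rule power_mono)
        have "real (1536 * (r + 1)) \<le> real U" using U_ge by (simp only: of_nat_le_iff)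
        then show "1536 * (real r + 1) \<le> real U" by simp
      qed simp
      finally show ?thesis unfolding t_def by (intro divide_left_mono) (auto simp: add_nonneg_pos U)
    qed
    show "n = 16 * U" by (rule n_def)
    show "2 \<le> U" "r \<le> U" using U_ge by auto
    show "32 * (real r + 1) * 2 ^ (r - 1) \<le> real (card {..<D}) * (real ((U - 1) choose k) * t ^ k)" if k: "k < r" for k
    proof -
      have UU: "real U \<ge> 1" "real r \<ge> 1" using U r by auto
      have "1 = (2 * real r * real U) ^ k * ((real U / (2 * real r)) ^ k * t ^ k)"
        unfolding t_def power_mult_distrib[symmetric] using UU by (simp add: power2_eq_square)
      also have "\<dots> \<le> (2 * real r * real U) ^ (r - 1) * (real ((U - 1) choose k) * t ^ k)"
      proof (rule mult_mono)
        have "1 * 1 \<le> 2 * real r * real U" using UU by (intro mult_mono) auto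
        then show "(2 * real r * real U) ^ k \<le> (2 * real r * real U) ^ (r - 1)"
          using k by (intro power_increasing) auto
        show "(real U / (2 * real r)) ^ k * t ^ k \<le> real ((U - 1) choose k) * t ^ k"
          using binomial_lower[OF k U(2)] by (intro mult_right_mono) (auto simp: t_def)
      qed (auto simp: t_def)
      finally have "32 * (real r + 1) * 2 ^ (r - 1) * 1
          \<le> 32 * (real r + 1) * 2 ^ (r - 1) * ((2 * real r * real U) ^ (r - 1) * (real ((U - 1) choose k) * t ^ k))"
        by (intro mult_left_mono) auto
      also have "\<dots> = 32 * (real r + 1) * (2 * (2 * real r * real U)) ^ (r - 1) * (real ((U - 1) choose k) * t ^ k)"
        unfolding power_mult_distrib[of 2 "2 * real r * real U"] by (simp only: mult.assoc)
      also have "32 * (real r + 1) * (2 * (2 * real r * real U)) ^ (r - 1) = real (card {..<D})"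
        unfolding D_def by (simp add: algebra_simps)
      finally show ?thesis by simp
    qed
    show "a = 8 * (r + 1)\<^sup>2" by (rule a_def)
    show "12 * g = 12 * g" ..
    show "g > 0" unfolding g_def using n by simp
    show "H > 0" unfolding H_def using r Q by simp
    show "(1 + t) ^ (2 * a * card (cube D n)) \<le> 8 ^ g"
    proof -
      define X where "X = (r + 1)\<^sup>2 * n ^ (D - 2)"
      have "(1 + t) ^ (2 * a * card (cube D n)) \<le> exp t ^ (2 * a * card (cube D n))"
        using exp_ge_add_one_self[of t] by (intro power_mono) (auto simp: t_def)
      also have "\<dots> = exp (real (2 * a * card (cube D n)) * t)" by (rule exp_of_nat_mult[symmetric])
      also have "real (2 * a * card (cube D n)) * t = real (4096 * X) * 1"
      proof -
        have "real (2 * a * card (cube D n)) * t = 16 * real ((r + 1)\<^sup>2) * (real n ^ (D - 2) * (real n)\<^sup>2) * t"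
          unfolding cube_card a_def of_nat_mult of_nat_power[of n] nD by simp
        also have "(real n)\<^sup>2 = 256 * (real U)\<^sup>2" unfolding n_def by (simp add: power_mult_distrib)
        finally show ?thesis unfolding t_def X_def using U by simp
      qed
      also have "exp (real (4096 * X) * 1) = exp 1 ^ (4096 * X)" by (rule exp_of_nat_mult)
      also have "\<dots> \<le> 4 ^ (4096 * X)"
      proof (rule power_mono)
        show "exp 1 \<le> (4::real)" using exp_le by linarith
      qed simp
      also have "4 ^ (4096 * X) = (2::real) ^ (8192 * X)"
        using power_mult[of "2::real" 2 "4096 * X"] by simp
      also have "\<dots> \<le> 2 ^ (9216 * X)" by (intro power_increasing) auto
      also have "\<dots> = 8 ^ (3072 * X)" using power_mult[of "2::real" 3 "3072 * X"] by simp
      also have "3072 * X = g" unfolding X_def g_def by simp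
      finally show ?thesis .
    qed
    have eq: "48 * (real (card {..<D}) * (real Q / real U) ^ (r - 1)) = real H"
    proof -
      have "real (card {..<D}) = 32 * (real r + 1) * (4 * real r) ^ (r - 1) * real U ^ (r - 1)"
        unfolding D_def by (simp add: power_mult_distrib add.commute)
      moreover have "real H = 1536 * (real r + 1) * (4 * real r) ^ (r - 1) * real Q ^ (r - 1)"
        unfolding H_def by (simp add: power_mult_distrib add.commute)
      ultimately show ?thesis using U by (simp add: power_divide)
    qed
    then show "48 * (real (card {..<D}) * (real (12 * g) * real n / real (card (cube D n))) ^ (r - 1)) \<le> real H"
      unfolding lam by simp
    have "48 * (real (card {..<D}) * (real Q / real U) ^ r)
        = 48 * (real (card {..<D}) * (real Q / real U) ^ (r - 1)) * (real Q / real U)"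
      using r by (cases r) auto
    also have "\<dots> = 1536 * (real r + 1) * (4 * real r) ^ (r - 1) * (real Q ^ (r - 1) * real Q) / real U"
      unfolding eq H_def by (simp add: power_mult_distrib add.commute)
    also have "real Q ^ (r - 1) * real Q = real Q ^ r" using r by (cases r) auto
    also have "1536 * (real r + 1) * (4 * real r) ^ (r - 1) * real Q ^ r = real U"
      unfolding U_def by (simp add: add.commute)
    finally show "48 * (real (card {..<D}) * (real (12 * g) * real n / real (card (cube D n))) ^ r) \<le> 1"
      unfolding lam using U by simp
  qed
  then obtain V where V: "V \<subseteq> cube D n" "\<forall>i\<in>{..<D}. \<forall>v\<in>V. card (V \<inter> axis D n i v) \<le> r"
    "\<forall>v\<in>V. card {i\<in>{..<D}. r \<le> card (V \<inter> axis D n i v)} \<le> H"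
    "\<not> (\<exists>A B. V = A \<union> B \<and> indep A \<and> indep B)" by (elim exE conjE) (rule that)
  show ?thesis
    by (intro exI[of _ D] exI[of _ n] exI[of _ V] conjI D n V(1,2,4)) (fact V(3)[unfolded H_def Q_def])
qed

section \<open>Explicit configurations for \<open>r = 1\<close> and \<open>r = 2\<close>, the cube
  for larger \<open>r\<close>\<close>

theorem theorem2p5:
  fixes r :: nat and T :: nat
  assumes "r > 0" and "T = r ^ (5 * r ^ 2)"
  shows "\<exists>(P :: (real \<times> real) set) (L :: (real \<times> real) set set).
    finite P \<and> finite L \<and> (\<forall>l\<in>L. is_line l) \<and>
    (\<forall>p\<in>P. card {l\<in>L. p \<in> l} \<ge> r) \<and>
    (\<forall>l\<in>L. card {l'\<in>L. l' \<noteq> l \<and> l \<inter> l' \<inter> P \<noteq> {}} \<le> T) \<and>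
    \<not> (\<exists>L1 L2. L1 \<union> L2 = L \<and> L1 \<inter> L2 = {} \<and>
          (\<forall>p\<in>P. (\<exists>l\<in>L1. p \<in> l) \<and> (\<exists>l\<in>L2. p \<in> l)))"
proof -
  consider "r = 1" | "r = 2" | "3 \<le> r" using assms(1) by linarith
  then show ?thesis
  proof cases
    case 1
    \<comment> \<open>One point on one line: two disjoint classes cannot both cover it.\<close>
    define l :: "(real \<times> real) set" where "l = {(x, y). x = 0}"
    have "l = {(x, y). 1 * x + 0 * y = 0}" unfolding l_def by auto
    then have "is_line l" unfolding is_line_def by (metis zero_neq_one)
    moreover have "{l' \<in> {l}. (0, 0) \<in> l'} = {l}" unfolding l_def by auto
    then have "\<forall>p\<in>{(0, 0)}. card {l' \<in> {l}. p \<in> l'} \<ge> r" using 1 by simp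
    moreover have "\<forall>l'\<in>{l}. card {l'' \<in> {l}. l'' \<noteq> l' \<and> l' \<inter> l'' \<inter> {(0, 0)} \<noteq> {}} \<le> T"
    proof
      fix l' assume "l' \<in> {l}"
      then have "{l'' \<in> {l}. l'' \<noteq> l' \<and> l' \<inter> l'' \<inter> {(0, 0)} \<noteq> {}} = {}" by blast
      then show "card {l'' \<in> {l}. l'' \<noteq> l' \<and> l' \<inter> l'' \<inter> {(0, 0)} \<noteq> {}} \<le> T"
        by (simp only: card.empty)
    qed
    moreover have "\<not> (\<exists>L1 L2. L1 \<union> L2 = {l} \<and> L1 \<inter> L2 = {} \<and>
          (\<forall>p\<in>{(0, 0)}. (\<exists>l\<in>L1. p \<in> l) \<and> (\<exists>l\<in>L2. p \<in> l)))"
    proof (intro notI, elim exE conjE)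
      fix L1 L2 assume L: "L1 \<union> L2 = {l}" "L1 \<inter> L2 = {}"
        and "\<forall>p\<in>{(0, 0)}. (\<exists>l\<in>L1. p \<in> l) \<and> (\<exists>l\<in>L2. p \<in> l)"
      then have "L1 \<noteq> {}" "L2 \<noteq> {}" by auto
      then have "L1 = {l}" "L2 = {l}"
        using L(1) subset_singletonD[of L1 l] subset_singletonD[of L2 l] by auto
      then show False using L(2) by simp
    qed
    ultimately show ?thesis by (intro exI[of _ "{(0, 0)}"] exI[of _ "{l}"]) simp
  next
    case 2
    \<comment> \<open>A triangle with its vertices: each vertex forces its two lines into different
      classes, which is impossible for three lines and two classes.\<close>
    define a b c :: "(real \<times> real) set" where "a = {(x, y). x = 0}" and "b = {(x, y). y = 0}"
      and "c = {(x, y). x + y = 1}"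
    have "a = {(x, y). 1 * x + 0 * y = 0}" "b = {(x, y). 0 * x + 1 * y = 0}" "c = {(x, y). 1 * x + 1 * y = 1}"
      unfolding a_def b_def c_def by auto
    then have lines: "is_line a" "is_line b" "is_line c" unfolding is_line_def by (metis zero_neq_one)+
    have mem: "(0, 0) \<in> a" "(0, 0) \<in> b" "(0, 0) \<notin> c" "(0, 1) \<in> a" "(0, 1) \<notin> b" "(0, 1) \<in> c"
      "(1, 0) \<notin> a" "(1, 0) \<in> b" "(1, 0) \<in> c"
      unfolding a_def b_def c_def by auto
    then have neq: "a \<noteq> b" "a \<noteq> c" "b \<noteq> c" by blast+
    let ?L = "{a, b, c}" and ?P = "{(0, 0), (0, 1), (1, 0)} :: (real \<times> real) set"
    have "{l\<in>?L. (0, 0) \<in> l} = {a, b}" "{l\<in>?L. (0, 1) \<in> l} = {a, c}" "{l\<in>?L. (1, 0) \<in> l} = {b, c}"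
      using mem by auto
    then have "\<forall>p\<in>?P. card {l\<in>?L. p \<in> l} \<ge> r" using neq 2 by auto
    moreover have "\<forall>l\<in>?L. card {l'\<in>?L. l' \<noteq> l \<and> l \<inter> l' \<inter> ?P \<noteq> {}} \<le> T"
    proof
      fix l
      have "card {l'\<in>?L. l' \<noteq> l \<and> l \<inter> l' \<inter> ?P \<noteq> {}} \<le> card ?L" by (intro card_mono) auto
      also have "\<dots> \<le> 3" by (simp add: card_insert_if)
      also have "\<dots> \<le> T" using 2 assms(2) by simp
      finally show "card {l'\<in>?L. l' \<noteq> l \<and> l \<inter> l' \<inter> ?P \<noteq> {}} \<le> T" .
    qed
    moreover have "\<not> (\<exists>L1 L2. L1 \<union> L2 = ?L \<and> L1 \<inter> L2 = {} \<and>
          (\<forall>p\<in>?P. (\<exists>l\<in>L1. p \<in> l) \<and> (\<exists>l\<in>L2. p \<in> l)))"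
    proof (intro notI, elim exE conjE)
      fix L1 L2 assume L: "L1 \<union> L2 = ?L" "L1 \<inter> L2 = {}"
        and cov: "\<forall>p\<in>?P. (\<exists>l\<in>L1. p \<in> l) \<and> (\<exists>l\<in>L2. p \<in> l)"
      have s: "l = a \<or> l = b \<or> l = c" if "l \<in> L1 \<or> l \<in> L2" for l
      proof -
        have "l \<in> L1 \<union> L2" using that by simp
        then show ?thesis unfolding L(1) by simp
      qed
      have "\<exists>l\<in>L1. (0, 0) \<in> l" "\<exists>l\<in>L2. (0, 0) \<in> l" using cov by simp_all
      then have "(a \<in> L1 \<or> b \<in> L1) \<and> (a \<in> L2 \<or> b \<in> L2)" using s mem(3) by metis
      moreover have "\<exists>l\<in>L1. (0, 1) \<in> l" "\<exists>l\<in>L2. (0, 1) \<in> l" using cov by simp_all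
      then have "(a \<in> L1 \<or> c \<in> L1) \<and> (a \<in> L2 \<or> c \<in> L2)" using s mem(5) by metis
      moreover have "\<exists>l\<in>L1. (1, 0) \<in> l" "\<exists>l\<in>L2. (1, 0) \<in> l" using cov by simp_all
      then have "(b \<in> L1 \<or> c \<in> L1) \<and> (b \<in> L2 \<or> c \<in> L2)" using s mem(7) by metis
      moreover have "\<not> (l \<in> L1 \<and> l \<in> L2)" for l using L(2) by auto
      ultimately show False by metis
    qed
    ultimately show ?thesis using lines by (intro exI[of _ ?P] exI[of _ ?L]) simp
  next
    case 3
    obtain D n V where *: "2 \<le> D" "0 < n" "V \<subseteq> cube D n"
      "\<forall>i\<in>{..<D}. \<forall>v\<in>V. card (V \<inter> axis D n i v) \<le> r"
      "\<forall>v\<in>V. card {i\<in>{..<D}. r \<le> card (V \<inter> axis D n i v)}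
         \<le> 1536 * (r + 1) * (4 * r * (2304 * (r + 1)\<^sup>2)) ^ (r - 1)"
      "\<not> (\<exists>A B. V = A \<union> B \<and> net.indep (cube D n) {..<D} (axis D n) r A
                      \<and> net.indep (cube D n) {..<D} (axis D n) r B)"
      using exists_uncolourable_cube[OF assms(1)] by (elim exE conjE) (rule that)
    show ?thesis
      by (rule realise_in_plane[OF *(1,2) assms(1) *(3-6)]) (simp only: assms(2) degree_bound[OF 3])
  qed
qed

end
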